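(* Let $R$ be a (left and right) Artinian ring. Then the map $$\mathrm{Loc}_l(R)\setminus\{[R]\}\to\mathrm{Loc}_r(R)\setminus\{[R]\},\qquad [R/(1-e_I)R]\mapsto[R/R(1-e_{CI})]\qquad (e_I\in\mathcal I_l''(R)),$$ is an anti-isomorphism of posets (i.e. an order-reversing bijection). In particular, $|\mathrm{Loc}_l(R)|=|\mathrm{Loc}_r(R)|$.
   Context: Rings are associative with $1\neq0$. A multiplicative set $S\subseteq R$ satisfies $1\in S$, $SS\subseteq S$, $0\notin S$. It is a left Ore set if $Sr\cap Rs\neq\emptyset$ for all $r\in R$, $s\in S$. A left Ore set $S$ is a left denominator set if $rs=0$ with $r\in R$, $s\in S$ implies $tr=0$ for some $t\in S$. Right denominator sets are the left denominator sets of the opposite ring. $\mathrm{Loc}_l(R)$ (respectively $\mathrm{Loc}_r(R)$) is the set of $R$-isomorphism classes $[A]$ of left localizations $A=S^{-1}R$ (respectively right localizations $A=RS^{-1}$) of $R$ at left (respectively right) denominator sets, where an $R$-isomorphism is a ring isomorphism commuting with the canonical maps from $R$. Both are partially ordered by: $[A]\to[B]$ if there is an $R$-homomorphism $A\to B$ (a ring homomorphism commuting with the canonical maps from $R$). Write $R/\mathrm{rad}(R)=\prod_{i=1}^s\overline R_i$, a product of simple Artinian rings ($\mathrm{rad}$ = Jacobson radical), with $\overline1_i$ the identity of $\overline R_i$. Fix orthogonal idempotents $1_1,\dots,1_s$ of $R$ with $1=\sum_i1_i$ and $1_i+\mathrm{rad}(R)=\overline1_i$. For $I\subseteq\{1,\dots,s\}$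 put $e_I=\sum_{i\in I}1_i$ and let $CI$ be the complement of $I$, so $1-e_I=e_{CI}$. Put $\mathcal I_l''(R)=\{e_I:\emptyset\neq I\subsetneq\{1,\dots,s\},\ e_IRe_{CI}=0\}$ and $\mathcal I_r''(R)=\{e_J:\emptyset\neq J\subsetneq\{1,\dots,s\},\ e_{CJ}Re_J=0\}$. One has $\mathrm{Loc}_l(R)\setminus\{[R]\}=\{[R/(1-e_I)R]:e_I\in\mathcal I_l''(R)\}$ and $\mathrm{Loc}_r(R)\setminus\{[R]\}=\{[R/R(1-e_J)]:e_J\in\mathcal I_r''(R)\}$. *)

theory Defs
  imports "HOL-Algebra.Algebra" "HOL-Library.Equipollence"
begin

section \<open>One-sided ideals, Artinian rings, the Jacobson radical\<close>

definition opp_ring :: "('a, 'm) ring_scheme \<Rightarrow> ('a, 'm) ring_scheme" where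
  "opp_ring R = R\<lparr>mult := \<lambda>x y. y \<otimes>\<^bsub>R\<^esub> x\<rparr>"

definition left_ideal :: "('a, 'm) ring_scheme \<Rightarrow> 'a set \<Rightarrow> bool" where
  "left_ideal R I \<longleftrightarrow>
     additive_subgroup I R \<and> (\<forall>a\<in>I. \<forall>x\<in>carrier R. x \<otimes>\<^bsub>R\<^esub> a \<in> I)"

definition left_artinian :: "('a, 'm) ring_scheme \<Rightarrow> bool" where
  "left_artinian R \<longleftrightarrow>
     (\<forall>I :: nat \<Rightarrow> 'a set. (\<forall>n. left_ideal R (I n)) \<and> (\<forall>n. I (Suc n) \<subseteq> I n) \<longrightarrow>
        (\<exists>N. \<forall>n\<ge>N. I n = I N))"

definition right_artinian :: "('a, 'm) ring_scheme \<Rightarrow> bool" where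
  "right_artinian R \<longleftrightarrow> left_artinian (opp_ring R)"

definition maximal_left_ideal :: "('a, 'm) ring_scheme \<Rightarrow> 'a set \<Rightarrow> bool" where
  "maximal_left_ideal R M \<longleftrightarrow>
     left_ideal R M \<and> M \<noteq> carrier R \<and>
     (\<forall>I. left_ideal R I \<and> M \<subseteq> I \<longrightarrow> I = M \<or> I = carrier R)"

definition jacobson_radical :: "('a, 'm) ring_scheme \<Rightarrow> 'a set" where
  "jacobson_radical R = carrier R \<inter> \<Inter>{M. maximal_left_ideal R M}"

definition simple_artinian :: "('a, 'm) ring_scheme \<Rightarrow> bool" where
  "simple_artinian R \<longleftrightarrow>
     ring R \<and> \<one>\<^bsub>R\<^esub> \<noteq> \<zero>\<^bsub>R\<^esub> \<and>
     (\<forall>I. ideal I R \<longrightarrow> I = {\<zero>\<^bsub>R\<^esub>} \<or> I = carrier R) \<and>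
     left_artinian R \<and> right_artinian R"

text \<open>The element of the product of the rings in \<^term>\<open>Rs\<close> whose \<^term>\<open>i\<close>-th component is
  the identity and whose other components vanish, i.e. the identity of the \<^term>\<open>i\<close>-th factor.\<close>

definition factor_one :: "('b, 'n) ring_scheme list \<Rightarrow> nat \<Rightarrow> 'b list" where
  "factor_one Rs i = map (\<lambda>j. if j = i then \<one>\<^bsub>Rs ! j\<^esub> else \<zero>\<^bsub>Rs ! j\<^esub>) [0..<length Rs]"


section \<open>Denominator sets and localizations\<close>

definition multiplicative_set :: "('a, 'm) ring_scheme \<Rightarrow> 'a set \<Rightarrow> bool" where
  "multiplicative_set R S \<longleftrightarrow> submonoid S R \<and> \<zero>\<^bsub>R\<^esub> \<notin> S"

definition left_ore_set :: "('a, 'm) ring_scheme \<Rightarrow> 'a set \<Rightarrow> bool" where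
  "left_ore_set R S \<longleftrightarrow> multiplicative_set R S \<and>
     (\<forall>r\<in>carrier R. \<forall>s\<in>S. (S #>\<^bsub>R\<^esub> r) \<inter> (carrier R #>\<^bsub>R\<^esub> s) \<noteq> {})"

definition left_denominator_set :: "('a, 'm) ring_scheme \<Rightarrow> 'a set \<Rightarrow> bool" where
  "left_denominator_set R S \<longleftrightarrow> left_ore_set R S \<and>
     (\<forall>r\<in>carrier R. \<forall>s\<in>S. r \<otimes>\<^bsub>R\<^esub> s = \<zero>\<^bsub>R\<^esub> \<longrightarrow> (\<exists>t\<in>S. t \<otimes>\<^bsub>R\<^esub> r = \<zero>\<^bsub>R\<^esub>))"

definition right_denominator_set :: "('a, 'm) ring_scheme \<Rightarrow> 'a set \<Rightarrow> bool" where
  "right_denominator_set R S \<longleftrightarrow> left_denominator_set (opp_ring R) S"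

text \<open>\<^term>\<open>A\<close> with the canonical map \<^term>\<open>\<sigma>\<close> is the left localization of \<^term>\<open>R\<close> at
  \<^term>\<open>S\<close>: the elements of \<^term>\<open>S\<close> become units, every element is a left fraction, and
  the kernel of \<^term>\<open>\<sigma>\<close> consists of the elements annihilated from the left by an element
  of \<^term>\<open>S\<close>.\<close>

definition left_localization ::
    "('a, 'm) ring_scheme \<Rightarrow> 'a set \<Rightarrow> ('b, 'n) ring_scheme \<Rightarrow> ('a \<Rightarrow> 'b) \<Rightarrow> bool" where
  "left_localization R S A \<sigma> \<longleftrightarrow>
     ring A \<and> \<sigma> \<in> ring_hom R A \<and>
     (\<forall>s\<in>S. \<sigma> s \<in> Units A) \<and>
     (\<forall>a\<in>carrier A. \<exists>s\<in>S. \<exists>r\<in>carrier R. a = inv\<^bsub>A\<^esub> (\<sigma> s) \<otimes>\<^bsub>A\<^esub> \<sigma> r) \<and>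
     (\<forall>r\<in>carrier R. \<sigma> r = \<zero>\<^bsub>A\<^esub> \<longleftrightarrow> (\<exists>s\<in>S. s \<otimes>\<^bsub>R\<^esub> r = \<zero>\<^bsub>R\<^esub>))"

definition right_localization ::
    "('a, 'm) ring_scheme \<Rightarrow> 'a set \<Rightarrow> ('b, 'n) ring_scheme \<Rightarrow> ('a \<Rightarrow> 'b) \<Rightarrow> bool" where
  "right_localization R S A \<sigma> \<longleftrightarrow> left_localization (opp_ring R) S (opp_ring A) \<sigma>"

definition R_hom ::
    "('a, 'm) ring_scheme \<Rightarrow> ('b, 'n) ring_scheme \<Rightarrow> ('a \<Rightarrow> 'b) \<Rightarrow>
     ('c, 'k) ring_scheme \<Rightarrow> ('a \<Rightarrow> 'c) \<Rightarrow> ('b \<Rightarrow> 'c) set" where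
  "R_hom R A \<sigma> B \<tau> = {h \<in> ring_hom A B. \<forall>r\<in>carrier R. h (\<sigma> r) = \<tau> r}"

definition R_iso ::
    "('a, 'm) ring_scheme \<Rightarrow> ('b, 'n) ring_scheme \<Rightarrow> ('a \<Rightarrow> 'b) \<Rightarrow>
     ('c, 'k) ring_scheme \<Rightarrow> ('a \<Rightarrow> 'c) \<Rightarrow> ('b \<Rightarrow> 'c) set" where
  "R_iso R A \<sigma> B \<tau> = {h \<in> ring_iso A B. \<forall>r\<in>carrier R. h (\<sigma> r) = \<tau> r}"

text \<open>Isomorphism classes are formed among the rings whose elements are sets of pairs over
  \<^typ>\<open>'a\<close>. A fraction can be encoded as the set of the pairs (denominator, numerator) that
  represent it, so every left or right localization of \<^term>\<open>R\<close>, whatever the type of its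
  elements, has an isomorphic copy there; see \<open>R_class_in_Loc_l\<close> and \<open>R_class_in_Loc_r\<close>
  below.\<close>

type_synonym 'a R_ring = "('a \<times> 'a) set ring \<times> ('a \<Rightarrow> ('a \<times> 'a) set)"

definition R_class ::
    "('a, 'm) ring_scheme \<Rightarrow> ('b, 'n) ring_scheme \<Rightarrow> ('a \<Rightarrow> 'b) \<Rightarrow> 'a R_ring set" where
  "R_class R A \<sigma> = {(B, \<tau>). ring B \<and> \<tau> \<in> ring_hom R B \<and> R_iso R A \<sigma> B \<tau> \<noteq> {}}"

definition Loc_l :: "('a, 'm) ring_scheme \<Rightarrow> 'a R_ring set set" where
  "Loc_l R = {R_class R A \<sigma> | S A (\<sigma> :: 'a \<Rightarrow> ('a \<times> 'a) set).
     left_denominator_set R S \<and> left_localization R S (A :: ('a \<times> 'a) set ring) \<sigma>}"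

definition Loc_r :: "('a, 'm) ring_scheme \<Rightarrow> 'a R_ring set set" where
  "Loc_r R = {R_class R A \<sigma> | S A (\<sigma> :: 'a \<Rightarrow> ('a \<times> 'a) set).
     right_denominator_set R S \<and> right_localization R S (A :: ('a \<times> 'a) set ring) \<sigma>}"

definition loc_le :: "('a, 'm) ring_scheme \<Rightarrow> 'a R_ring set \<Rightarrow> 'a R_ring set \<Rightarrow> bool" where
  "loc_le R C D \<longleftrightarrow>
     (\<exists>A \<sigma> B \<tau>. (A, \<sigma>) \<in> C \<and> (B, \<tau>) \<in> D \<and> R_hom R A \<sigma> B \<tau> \<noteq> {})"

abbreviation base_class :: "('a, 'm) ring_scheme \<Rightarrow> 'a R_ring set" where
  "base_class R \<equiv> R_class R R (\<lambda>r. r)"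

abbreviation quot_class :: "('a, 'm) ring_scheme \<Rightarrow> 'a set \<Rightarrow> 'a R_ring set" where
  "quot_class R I \<equiv> R_class R (R Quot I) (\<lambda>r. I +>\<^bsub>R\<^esub> r)"


section \<open>The idempotents attached to sets of simple factors\<close>

text \<open>The family \<^term>\<open>e\<close> is indexed by \<^term>\<open>{..<s}\<close>.\<close>

definition idem_sum :: "('a, 'm) ring_scheme \<Rightarrow> (nat \<Rightarrow> 'a) \<Rightarrow> nat set \<Rightarrow> 'a" where
  "idem_sum R e I = finsum R e I"

definition idem_l :: "('a, 'm) ring_scheme \<Rightarrow> nat \<Rightarrow> (nat \<Rightarrow> 'a) \<Rightarrow> 'a set" where
  "idem_l R s e = {idem_sum R e I | I. I \<noteq> {} \<and> I \<subset> {..<s} \<and>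
     (idem_sum R e I <#\<^bsub>R\<^esub> carrier R) #>\<^bsub>R\<^esub> idem_sum R e ({..<s} - I) = {\<zero>\<^bsub>R\<^esub>}}"


section \<open>Every localization is represented\<close>

lemma opp_ring_simps [simp]:
  "carrier (opp_ring R) = carrier R" "x \<otimes>\<^bsub>opp_ring R\<^esub> y = y \<otimes>\<^bsub>R\<^esub> x"
  "\<one>\<^bsub>opp_ring R\<^esub> = \<one>\<^bsub>R\<^esub>" "\<zero>\<^bsub>opp_ring R\<^esub> = \<zero>\<^bsub>R\<^esub>"
  "x \<oplus>\<^bsub>opp_ring R\<^esub> y = x \<oplus>\<^bsub>R\<^esub> y" "opp_ring (opp_ring R) = R"
  by (simp_all add: opp_ring_def)

lemma ring_opp_ring:
  assumes "ring R"
  shows "ring (opp_ring R)"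
proof (rule ringI)
  interpret ring R by fact
  show "abelian_group (opp_ring R)"
    by (rule abelian_groupI) (auto simp: a_ac intro: l_neg)
  show "monoid (opp_ring R)"
    by (rule monoidI) (auto simp: m_assoc)
qed (auto simp: ring.ring_simprules[OF assms])

lemma ring_hom_opp_ring [simp]: "ring_hom (opp_ring A) (opp_ring B) = ring_hom A B"
  by (auto simp: ring_hom_def)

lemma ring_iso_opp_ring [simp]: "ring_iso (opp_ring A) (opp_ring B) = ring_iso A B"
  by (auto simp: ring_iso_def)

lemma R_class_eqI:
  assumes "h \<in> R_iso R A \<sigma> B \<tau>" "ring A" "\<sigma> \<in> ring_hom R A"
  shows "R_class R A \<sigma> = R_class R B \<tau>"
proof -
  have h: "h \<in> ring_iso A B" "\<And>r. r \<in> carrier R \<Longrightarrow> h (\<sigma> r) = \<tau> r"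
    using assms(1) by (auto simp: R_iso_def)
  let ?g = "inv_into (carrier A) h"
  have g: "?g \<in> ring_iso B A"
    using ring_iso_set_sym[OF assms(2) h(1)] .
  have g\<tau>: "?g (\<tau> r) = \<sigma> r" if "r \<in> carrier R" for r
    using h that assms(3) by (metis inv_into_f_f ring_iso_memE(5) bij_betw_def ring_hom_closed)
  have "k \<circ> ?g \<in> R_iso R B \<tau> C \<upsilon>" if "k \<in> R_iso R A \<sigma> C \<upsilon>" for k and C :: "'x ring" and \<upsilon>
    using that g g\<tau> by (auto simp: R_iso_def intro: ring_iso_set_trans)
  moreover have "k \<circ> h \<in> R_iso R A \<sigma> C \<upsilon>" if "k \<in> R_iso R B \<tau> C \<upsilon>" for k and C :: "'x ring" and \<upsilon>
    using that h by (auto simp: R_iso_def intro: ring_iso_set_trans)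
  ultimately show ?thesis
    unfolding R_class_def by blast
qed

lemma left_localization_iso:
  assumes "S \<subseteq> carrier R" "left_localization R S A \<sigma>" "h \<in> ring_iso A B" "ring B"
  shows "left_localization R S B (h \<circ> \<sigma>)"
proof -
  interpret A: ring A using assms(2) by (simp add: left_localization_def)
  interpret B: ring B by fact
  have hom: "h \<in> ring_hom A B" and bij: "bij_betw h (carrier A) (carrier B)"
    using assms(3) by (auto simp: ring_iso_def)
  interpret h: ring_hom_ring A B h
    using hom by (intro ring_hom_ringI2 A.ring_axioms B.ring_axioms)
  have \<sigma>: "\<sigma> \<in> ring_hom R A"
    using assms(2) by (simp add: left_localization_def)
  have \<sigma>_closed: "\<sigma> r \<in> carrier A" if "r \<in> carrier R" for r
    using ring_hom_closed[OF \<sigma> that] .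
  have units: "h u \<in> Units B \<and> inv\<^bsub>B\<^esub> (h u) = h (inv\<^bsub>A\<^esub> u)" if u: "u \<in> Units A" for u
  proof -
    have c: "u \<in> carrier A" "inv\<^bsub>A\<^esub> u \<in> carrier A" using u by auto
    have *: "h u \<otimes>\<^bsub>B\<^esub> h (inv\<^bsub>A\<^esub> u) = \<one>\<^bsub>B\<^esub>" "h (inv\<^bsub>A\<^esub> u) \<otimes>\<^bsub>B\<^esub> h u = \<one>\<^bsub>B\<^esub>"
      using u c by (simp_all flip: h.hom_mult)
    have "inv\<^bsub>B\<^esub> (h u) = h (inv\<^bsub>A\<^esub> u)"
      using c * by (intro B.inv_char) auto
    moreover have "h u \<in> Units B"
      unfolding Units_def using c * by (auto intro!: bexI[of _ "h (inv\<^bsub>A\<^esub> u)"])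
    ultimately show ?thesis by blast
  qed
  have S_units: "\<sigma> s \<in> Units A" if "s \<in> S" for s
    using assms(2) that by (simp add: left_localization_def)
  have "\<exists>s\<in>S. \<exists>r\<in>carrier R. b = inv\<^bsub>B\<^esub> h (\<sigma> s) \<otimes>\<^bsub>B\<^esub> h (\<sigma> r)" if "b \<in> carrier B" for b
  proof -
    obtain a where a: "a \<in> carrier A" "b = h a"
      using bij \<open>b \<in> carrier B\<close> by (auto simp: bij_betw_def)
    then obtain s r where sr: "s \<in> S" "r \<in> carrier R" "a = inv\<^bsub>A\<^esub> (\<sigma> s) \<otimes>\<^bsub>A\<^esub> \<sigma> r"
      using assms(2) by (auto simp: left_localization_def)
    have "b = inv\<^bsub>B\<^esub> h (\<sigma> s) \<otimes>\<^bsub>B\<^esub> h (\<sigma> r)"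
      using a sr units[OF S_units] S_units \<sigma>_closed by simp
    then show ?thesis
      using sr by blast
  qed
  moreover have "h (\<sigma> r) = \<zero>\<^bsub>B\<^esub> \<longleftrightarrow> \<sigma> r = \<zero>\<^bsub>A\<^esub>" if "r \<in> carrier R" for r
    using bij \<sigma>_closed[OF that] by (metis A.zero_closed bij_betw_def h.hom_zero inj_onD)
  ultimately show ?thesis
    using assms(2) units ring_hom_trans[OF \<sigma> hom] B.ring_axioms
    by (auto simp: left_localization_def)
qed

lemma fraction_encoding:
  assumes "left_localization R S A \<sigma>"
  shows "inj_on (\<lambda>a. {(s, r). s \<in> S \<and> r \<in> carrier R \<and> a = inv\<^bsub>A\<^esub> (\<sigma> s) \<otimes>\<^bsub>A\<^esub> \<sigma> r}) (carrier A)"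
proof (rule inj_onI)
  fix a b
  assume a: "a \<in> carrier A"
    and eq: "{(s, r). s \<in> S \<and> r \<in> carrier R \<and> a = inv\<^bsub>A\<^esub> (\<sigma> s) \<otimes>\<^bsub>A\<^esub> \<sigma> r} =
             {(s, r). s \<in> S \<and> r \<in> carrier R \<and> b = inv\<^bsub>A\<^esub> (\<sigma> s) \<otimes>\<^bsub>A\<^esub> \<sigma> r}"
  obtain s r where "s \<in> S" "r \<in> carrier R" "a = inv\<^bsub>A\<^esub> (\<sigma> s) \<otimes>\<^bsub>A\<^esub> \<sigma> r"
    using assms a by (auto simp: left_localization_def)
  then have "(s, r) \<in> {(s, r). s \<in> S \<and> r \<in> carrier R \<and> a = inv\<^bsub>A\<^esub> (\<sigma> s) \<otimes>\<^bsub>A\<^esub> \<sigma> r}"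
    by simp
  then have "b = inv\<^bsub>A\<^esub> (\<sigma> s) \<otimes>\<^bsub>A\<^esub> \<sigma> r"
    unfolding eq by simp
  then show "a = b"
    using \<open>a = _\<close> by simp
qed

lemma left_denominator_set_subset: "left_denominator_set R S \<Longrightarrow> S \<subseteq> carrier R"
  by (simp add: left_denominator_set_def left_ore_set_def multiplicative_set_def submonoid.subset)

theorem R_class_in_Loc_l:
  fixes A :: "('b, 'n) ring_scheme"
  assumes "left_denominator_set R S" "left_localization R S A \<sigma>"
  shows "R_class R A \<sigma> \<in> Loc_l R"
proof -
  let ?f = "\<lambda>a. {(s, r). s \<in> S \<and> r \<in> carrier R \<and> a = inv\<^bsub>A\<^esub> (\<sigma> s) \<otimes>\<^bsub>A\<^esub> \<sigma> r}"
  have A: "ring A" "\<sigma> \<in> ring_hom R A"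
    using assms(2) by (auto simp: left_localization_def)
  have iso: "?f \<in> ring_iso A (image_ring ?f A)"
    using inj_imp_image_ring_iso[OF fraction_encoding[OF assms(2)]] .
  have B: "ring (image_ring ?f A)"
    using ring.inj_imp_image_ring_is_ring[OF A(1) fraction_encoding[OF assms(2)]] .
  have "left_localization R S (image_ring ?f A) (?f \<circ> \<sigma>)"
    by (rule left_localization_iso[OF left_denominator_set_subset[OF assms(1)] assms(2) iso B])
  moreover have "R_class R A \<sigma> = R_class R (image_ring ?f A) (?f \<circ> \<sigma>)"
    using iso by (intro R_class_eqI[OF _ A]) (auto simp: R_iso_def)
  ultimately show ?thesis
    unfolding Loc_l_def using assms(1) by blast
qed

theorem R_class_in_Loc_r:
  fixes A :: "('b, 'n) ring_scheme"
  assumes "right_denominator_set R S" "right_localization R S A \<sigma>"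
  shows "R_class R A \<sigma> \<in> Loc_r R"
proof -
  let ?O = "opp_ring A"
  let ?f = "\<lambda>a. {(s, r). s \<in> S \<and> r \<in> carrier (opp_ring R) \<and> a = inv\<^bsub>?O\<^esub> (\<sigma> s) \<otimes>\<^bsub>?O\<^esub> \<sigma> r}"
  have den: "left_denominator_set (opp_ring R) S" and loc: "left_localization (opp_ring R) S ?O \<sigma>"
    using assms by (auto simp: right_denominator_set_def right_localization_def)
  have A: "ring A" "\<sigma> \<in> ring_hom R A"
    using loc ring_opp_ring[of ?O] by (auto simp: left_localization_def)
  have inj: "inj_on ?f (carrier A)"
    using fraction_encoding[OF loc] unfolding opp_ring_simps(1)[of A] .
  have iso: "?f \<in> ring_iso A (image_ring ?f A)"
    by (rule inj_imp_image_ring_iso[OF inj])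
  have B: "ring (image_ring ?f A)"
    by (rule ring.inj_imp_image_ring_is_ring[OF A(1) inj])
  have "right_localization R S (image_ring ?f A) (?f \<circ> \<sigma>)"
    unfolding right_localization_def
    using left_localization_iso[OF left_denominator_set_subset[OF den] loc _ ring_opp_ring[OF B]] iso
    by (simp only: ring_iso_opp_ring)
  moreover have "R_class R A \<sigma> = R_class R (image_ring ?f A) (?f \<circ> \<sigma>)"
    using iso by (intro R_class_eqI[OF _ A]) (auto simp: R_iso_def)
  ultimately show ?thesis
    unfolding Loc_r_def using assms(1) by blast
qed

end

theory Submission
  imports Defs
begin

text \<open>
Every localization of an Artinian ring turns out to be a quotient by an ideal of the form
\<open>e\<^sub>C\<^sub>I R\<close> (left case) or \<open>R e\<^sub>C\<^sub>I\<close> (right case), so that classes of localizations can be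
compared through the kernels of their canonical maps.

Let \<open>\<alpha> : R \<rightarrow> A\<close> be a left localization at \<open>S\<close> of a left Artinian ring. For \<open>t \<in> S\<close> the chain
\<open>R t \<supseteq> R t\<^sup>2 \<supseteq> \<dots>\<close> stops, and cancelling the unit \<open>\<alpha>(t)\<close> in \<open>t\<^sup>n = x t\<^sup>n\<^sup>+\<^sup>1\<close> shows that
\<open>\<alpha>(t)\<close> has its inverse in the image of \<open>\<alpha>\<close>; hence \<open>\<alpha>\<close> is onto. If \<open>R s\<close> is minimal among the
left ideals \<open>R t\<close> with \<open>t \<in> S\<close>, the Ore condition makes \<open>s\<close> annihilate all of \<open>ker \<alpha>\<close>. Choosing \<open>y\<close>
with \<open>\<alpha>(y)\<alpha>(s) = 1\<close> gives an idempotent \<open>f = y s\<close> with \<open>ker \<alpha> = {r. f r = 0} = (1 - f) R\<close>. As the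
kernel is an ideal, \<open>f R (1 - f) = 0\<close>, which is the same as \<open>f r f = f r\<close> for all \<open>r\<close> (\<open>f\<close> is right
semicentral). This is \<open>left_artinian_localization\<close>.

It remains to replace \<open>f\<close> by a member of the given family. In a simple ring the only right
semicentral elements are \<open>0\<close> and \<open>1\<close>, hence \<open>f\<close> is congruent modulo the radical to some \<open>e\<^sub>I\<close>
(\<open>semicentral_idempotent_mod_ideal\<close>). Since the radical contains no idempotent except \<open>0\<close>, the
congruence forces \<open>(1 - f) R = e\<^sub>C\<^sub>I R\<close> and \<open>e\<^sub>I R e\<^sub>C\<^sub>I = 0\<close> (\<open>kernel_of_congruent_idempotent\<close>).
Conversely, if \<open>e\<^sub>I R e\<^sub>C\<^sub>I = 0\<close>, the quotient by \<open>e\<^sub>C\<^sub>I R\<close> is the localization at \<open>{1, e\<^sub>I}\<close>.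

The properties of the family used here are symmetric under passage to the opposite ring (the locale
\<open>lifted_idempotents\<close>), which yields the right-hand classification. Both sides are parametrised by the
sets \<open>I\<close> with \<open>e\<^sub>I R e\<^sub>C\<^sub>I = 0\<close>: on the left through the ideals \<open>e\<^sub>C\<^sub>I R\<close>, which shrink as \<open>I\<close> grows,
on the right through the ideals \<open>R e\<^sub>I\<close>, which grow with \<open>I\<close>. Homomorphisms between quotients are
inclusions of kernels, so matching the two parametrisations reverses the order.
\<close>

section \<open>Classes of surjective images\<close>

text \<open>The class of \<open>R/K\<close>, written without choosing a model of the quotient: for an ideal \<open>K\<close> these
are the pairs that are \<open>R\<close>-isomorphic to \<open>R/K\<close>. The description is left-right symmetric, so it serves
left and right localizations alike.\<close>

definition quotients_by :: "('a, 'm) ring_scheme \<Rightarrow> 'a set \<Rightarrow> 'a R_ring set" where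
  "quotients_by R K = {(B, \<tau>). ring B \<and> \<tau> \<in> ring_hom R B \<and>
     \<tau> ` carrier R = carrier B \<and> a_kernel R B \<tau> = K}"

lemma hom_eq_iff_minus_in_kernel:
  fixes R (structure)
  assumes "ring R" "ring A" "\<alpha> \<in> ring_hom R A" "r \<in> carrier R" "r' \<in> carrier R"
  shows "\<alpha> r = \<alpha> r' \<longleftrightarrow> r \<ominus> r' \<in> a_kernel R A \<alpha>"
proof -
  interpret h: ring_hom_ring R A \<alpha>
    using assms by (simp add: ring_hom_ringI2)
  have diff: "\<alpha> (r \<ominus> r') = \<alpha> r \<ominus>\<^bsub>A\<^esub> \<alpha> r'"
    unfolding h.R.minus_eq h.S.minus_eq using assms(4,5) by simp
  have "r \<ominus> r' \<in> a_kernel R A \<alpha> \<longleftrightarrow> \<alpha> r \<ominus>\<^bsub>A\<^esub> \<alpha> r' = \<zero>\<^bsub>A\<^esub>"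
    unfolding a_kernel_def' mem_Collect_eq diff using assms(4,5) by blast
  also have "\<dots> \<longleftrightarrow> \<alpha> r = \<alpha> r'"
    by (rule h.S.r_right_minus_eq) (use assms(4,5) in auto)
  finally show ?thesis by (rule sym)
qed

text \<open>The homomorphism theorem for surjections onto arbitrary rings rather than onto a ring of cosets:
\<open>\<tau>\<close> is constant on the fibres of \<open>\<alpha>\<close>.\<close>

lemma induced_R_hom:
  assumes "ring R" "ring A" "ring B" "\<alpha> \<in> ring_hom R A" "\<tau> \<in> ring_hom R B"
    and surj: "\<alpha> ` carrier R = carrier A" and ker: "a_kernel R A \<alpha> \<subseteq> a_kernel R B \<tau>"
  obtains h where "h \<in> R_hom R A \<alpha> B \<tau>"
proof -
  interpret R: ring R by fact
  interpret s: ring_hom_ring R A \<alpha> using assms by (simp add: ring_hom_ringI2)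
  interpret t: ring_hom_ring R B \<tau> using assms by (simp add: ring_hom_ringI2)
  define h where "h a = \<tau> (SOME r. r \<in> carrier R \<and> \<alpha> r = a)" for a
  have h: "h (\<alpha> r) = \<tau> r" if r: "r \<in> carrier R" for r
  proof -
    let ?q = "SOME q. q \<in> carrier R \<and> \<alpha> q = \<alpha> r"
    have "?q \<in> carrier R \<and> \<alpha> ?q = \<alpha> r"
      using r by (intro someI_ex[of "\<lambda>q. q \<in> carrier R \<and> \<alpha> q = \<alpha> r"]) blast
    then have "\<tau> ?q = \<tau> r"
      using hom_eq_iff_minus_in_kernel[OF assms(1,2,4)]
        hom_eq_iff_minus_in_kernel[OF assms(1,3,5)] r ker by blast
    then show ?thesis by (simp add: h_def)
  qed
  have "h \<in> ring_hom A B"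
  proof (rule ring_hom_memI)
    fix x y assume "x \<in> carrier A" "y \<in> carrier A"
    then obtain p q where pq: "p \<in> carrier R" "q \<in> carrier R" "x = \<alpha> p" "y = \<alpha> q"
      using surj by blast
    show "h x \<in> carrier B" using pq h by simp
    show "h (x \<otimes>\<^bsub>A\<^esub> y) = h x \<otimes>\<^bsub>B\<^esub> h y"
      using pq h[of "p \<otimes>\<^bsub>R\<^esub> q"] h by simp
    show "h (x \<oplus>\<^bsub>A\<^esub> y) = h x \<oplus>\<^bsub>B\<^esub> h y"
      using pq h[of "p \<oplus>\<^bsub>R\<^esub> q"] h by simp
  next
    show "h \<one>\<^bsub>A\<^esub> = \<one>\<^bsub>B\<^esub>" using h[of "\<one>\<^bsub>R\<^esub>"] by simp
  qed
  then have "h \<in> R_hom R A \<alpha> B \<tau>" using h by (simp add: R_hom_def)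
  then show ?thesis by (rule that)
qed

lemma R_hom_kernel_mono:
  assumes "ring A" "ring B" "h \<in> R_hom R A \<alpha> B \<tau>"
  shows "a_kernel R A \<alpha> \<subseteq> a_kernel R B \<tau>"
proof -
  interpret h: ring_hom_ring A B h
    using assms by (auto simp: R_hom_def intro: ring_hom_ringI2)
  show ?thesis
  proof
    fix r assume "r \<in> a_kernel R A \<alpha>"
    then have r: "r \<in> carrier R" "\<alpha> r = \<zero>\<^bsub>A\<^esub>" by (auto simp: a_kernel_def')
    then have "\<tau> r = h \<zero>\<^bsub>A\<^esub>" using assms(3) by (auto simp: R_hom_def)
    then show "r \<in> a_kernel R B \<tau>" using r by (simp add: a_kernel_def')
  qed
qed

text \<open>A surjective image of \<open>R\<close> is determined up to \<open>R\<close>-isomorphism by its kernel: induced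
homomorphisms exist in both directions.\<close>

lemma R_class_of_surjection:
  assumes "ring R" "ring A" "\<alpha> \<in> ring_hom R A" "\<alpha> ` carrier R = carrier A"
  shows "R_class R A \<alpha> = quotients_by R (a_kernel R A \<alpha>)"
proof -
  have "(B, \<tau>) \<in> R_class R A \<alpha> \<longleftrightarrow> (B, \<tau>) \<in> quotients_by R (a_kernel R A \<alpha>)" for B \<tau>
  proof
    assume "(B, \<tau>) \<in> R_class R A \<alpha>"
    then obtain h where B: "ring B" "\<tau> \<in> ring_hom R B" and h: "h \<in> R_iso R A \<alpha> B \<tau>"
      by (auto simp: R_class_def)
    have hi: "h \<in> ring_iso A B" and hs: "\<And>r. r \<in> carrier R \<Longrightarrow> h (\<alpha> r) = \<tau> r"
      using h by (auto simp: R_iso_def)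
    let ?g = "inv_into (carrier A) h"
    have g: "?g \<in> ring_iso B A" by (rule ring_iso_set_sym[OF assms(2) hi])
    have bij: "bij_betw h (carrier A) (carrier B)" using hi by (simp add: ring_iso_def)
    have gt: "?g (\<tau> r) = \<alpha> r" if "r \<in> carrier R" for r
      using bij hs[OF that] ring_hom_closed[OF assms(3) that]
      by (metis bij_betw_def inv_into_f_f)
    have "a_kernel R A \<alpha> \<subseteq> a_kernel R B \<tau>"
      using hi hs by (intro R_hom_kernel_mono[OF assms(2) B(1)]) (auto simp: R_hom_def ring_iso_def)
    moreover have "a_kernel R B \<tau> \<subseteq> a_kernel R A \<alpha>"
      using g gt
      by (intro R_hom_kernel_mono[OF B(1) assms(2), of ?g]) (auto simp: R_hom_def ring_iso_def)
    moreover have "\<tau> ` carrier R = carrier B"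
    proof -
      have "\<tau> ` carrier R = h ` \<alpha> ` carrier R" using hs by (force simp: image_image)
      then show ?thesis using assms(4) bij by (simp add: bij_betw_def)
    qed
    ultimately show "(B, \<tau>) \<in> quotients_by R (a_kernel R A \<alpha>)"
      using B by (auto simp: quotients_by_def)
  next
    assume "(B, \<tau>) \<in> quotients_by R (a_kernel R A \<alpha>)"
    then have B: "ring B" "\<tau> \<in> ring_hom R B" "\<tau> ` carrier R = carrier B"
      and ker: "a_kernel R B \<tau> = a_kernel R A \<alpha>"
      by (auto simp: quotients_by_def)
    obtain h where h: "h \<in> R_hom R A \<alpha> B \<tau>"
      using induced_R_hom[OF assms(1,2) B(1) assms(3) B(2) assms(4)] ker by blast
    then have hs: "\<And>r. r \<in> carrier R \<Longrightarrow> h (\<alpha> r) = \<tau> r" by (simp add: R_hom_def)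
    have "inj_on h (carrier A)"
    proof (rule inj_onI)
      fix x y assume xy: "x \<in> carrier A" "y \<in> carrier A" "h x = h y"
      obtain p q where pq: "p \<in> carrier R" "q \<in> carrier R" "x = \<alpha> p" "y = \<alpha> q"
        using xy assms(4) by blast
      then have "\<tau> p = \<tau> q" using xy(3) hs by simp
      then show "x = y"
        using pq ker hom_eq_iff_minus_in_kernel[OF assms(1,2,3)]
          hom_eq_iff_minus_in_kernel[OF assms(1) B(1,2)] by blast
    qed
    moreover have "h ` carrier A = carrier B"
      using hs by (simp add: B(3)[symmetric] assms(4)[symmetric] image_image cong: image_cong)
    ultimately have "h \<in> R_iso R A \<alpha> B \<tau>"
      using h by (simp add: R_iso_def R_hom_def ring_iso_def bij_betw_def)
    then show "(B, \<tau>) \<in> R_class R A \<alpha>"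
      using B by (auto simp: R_class_def)
  qed
  then show ?thesis by auto
qed

lemma base_class_eq:
  assumes "ring R"
  shows "base_class R = quotients_by R {\<zero>\<^bsub>R\<^esub>}"
proof -
  interpret ring R by fact
  have "a_kernel R R (\<lambda>r. r) = {\<zero>\<^bsub>R\<^esub>}" by (auto simp: a_kernel_def')
  moreover have "(\<lambda>r. r) \<in> ring_hom R R" by (rule ring_hom_memI) auto
  ultimately show ?thesis
    using R_class_of_surjection[OF assms assms, of "\<lambda>r. r"] by simp
qed

lemma quotient_map_properties:
  assumes "ideal I R"
  shows "(\<lambda>r. I +>\<^bsub>R\<^esub> r) \<in> ring_hom R (R Quot I)"
    and "(\<lambda>r. I +>\<^bsub>R\<^esub> r) ` carrier R = carrier (R Quot I)"
    and "a_kernel R (R Quot I) (\<lambda>r. I +>\<^bsub>R\<^esub> r) = I"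
proof -
  interpret ideal I R by fact
  show "(\<lambda>r. I +>\<^bsub>R\<^esub> r) \<in> ring_hom R (R Quot I)"
    using rcos_ring_hom .
  show "(\<lambda>r. I +>\<^bsub>R\<^esub> r) ` carrier R = carrier (R Quot I)"
    by (auto simp: FactRing_def A_RCOSETS_def')
  show "a_kernel R (R Quot I) (\<lambda>r. I +>\<^bsub>R\<^esub> r) = I"
    using rcos_const_imp_mem a_rcos_const by (auto simp: a_kernel_def' FactRing_def)
qed

lemma quot_class_eq:
  assumes "ideal I R"
  shows "quot_class R I = quotients_by R I"
  using R_class_of_surjection[OF ideal.axioms(2)[OF assms] ideal.quotient_is_ring[OF assms]
      quotient_map_properties(1,2)[OF assms]]
  by (simp add: quotient_map_properties(3)[OF assms])

text \<open>The classes only contain rings whose elements are sets of pairs, so the cosets have to be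
transported to that type; \<open>Y \<mapsto> Y \<times> Y\<close> is an injection that does it. Nonemptiness makes the order
\<open>loc_le\<close>, which asks for representatives, meaningful on these classes.\<close>

lemma quotients_by_nonempty:
  assumes "ideal I R"
  shows "quotients_by R I \<noteq> {}"
proof -
  let ?Q = "R Quot I"
  let ?f = "\<lambda>Y :: 'a set. Y \<times> Y"
  have Q: "ring ?Q" by (rule ideal.quotient_is_ring[OF assms])
  have inj: "inj_on ?f (carrier ?Q)"
    by (rule inj_onI) auto
  have iso: "?f \<in> ring_iso ?Q (image_ring ?f ?Q)"
    by (rule inj_imp_image_ring_iso[OF inj])
  then have "?f \<circ> (\<lambda>r. I +>\<^bsub>R\<^esub> r) \<in> ring_hom R (image_ring ?f ?Q)"
    using quotient_map_properties(1)[OF assms] by (intro ring_hom_trans) (auto simp: ring_iso_def)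
  then have "(image_ring ?f ?Q, ?f \<circ> (\<lambda>r. I +>\<^bsub>R\<^esub> r)) \<in> quot_class R I"
    using iso ring.inj_imp_image_ring_is_ring[OF Q inj]
    by (auto simp: R_class_def R_iso_def)
  then show ?thesis using quot_class_eq[OF assms] by blast
qed

lemma quotients_by_eq_iff:
  assumes "ideal I R"
  shows "quotients_by R I = quotients_by R K \<longleftrightarrow> I = K"
proof
  assume eq: "quotients_by R I = quotients_by R K"
  obtain B \<tau> where B: "(B, \<tau>) \<in> quotients_by R I"
    using quotients_by_nonempty[OF assms] by fast
  then have "(B, \<tau>) \<in> quotients_by R K" unfolding eq .
  then show "I = K" using B unfolding quotients_by_def by blast
qed (rule arg_cong)

lemma loc_le_quotients_by_iff:
  assumes "ideal I R" "ideal K R"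
  shows "loc_le R (quotients_by R I) (quotients_by R K) \<longleftrightarrow> I \<subseteq> K"
proof
  assume "loc_le R (quotients_by R I) (quotients_by R K)"
  then obtain A \<alpha> B \<tau> h where "(A, \<alpha>) \<in> quotients_by R I" "(B, \<tau>) \<in> quotients_by R K"
    "h \<in> R_hom R A \<alpha> B \<tau>" unfolding loc_le_def by blast
  then show "I \<subseteq> K"
    using R_hom_kernel_mono[of A B h R \<alpha> \<tau>] unfolding quotients_by_def by blast
next
  assume IK: "I \<subseteq> K"
  obtain A \<alpha> B \<tau> where AB: "(A, \<alpha>) \<in> quotients_by R I" "(B, \<tau>) \<in> quotients_by R K"
    using quotients_by_nonempty assms by (metis ex_in_conv surj_pair)
  obtain h where "h \<in> R_hom R A \<alpha> B \<tau>"
    using AB IK induced_R_hom[OF ideal.axioms(2)[OF assms(1)], of A B \<alpha> \<tau>]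
    by (auto simp: quotients_by_def)
  then show "loc_le R (quotients_by R I) (quotients_by R K)"
    using AB unfolding loc_le_def by blast
qed


section \<open>Left localizations of left Artinian rings\<close>

text \<open>The descending chain condition in its equivalent form as a minimum condition, which is how the
denominator \<open>s\<close> with smallest \<open>R s\<close> is found.\<close>

lemma left_artinian_minimal:
  assumes "left_artinian R" "K \<in> \<A>" "\<And>I. I \<in> \<A> \<Longrightarrow> left_ideal R I"
  obtains M where "M \<in> \<A>" "\<And>I. I \<in> \<A> \<Longrightarrow> I \<subseteq> M \<Longrightarrow> I = M"
proof -
  let ?r = "{(I, H). I \<in> \<A> \<and> H \<in> \<A> \<and> I \<subset> H}"
  have "wf ?r"
    unfolding wf_iff_no_infinite_down_chain
  proof
    assume "\<exists>f. \<forall>i. (f (Suc i), f i) \<in> ?r"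
    then obtain f where f: "\<And>i. f i \<in> \<A>" "\<And>i. f (Suc i) \<subset> f i" by blast
    then obtain N where "\<forall>n\<ge>N. f n = f N"
      using assms(1,3) unfolding left_artinian_def by (metis psubset_imp_subset)
    then show False using f(2)[of N] by (metis le_SucI order_refl psubset_eq)
  qed
  then obtain M where M: "M \<in> \<A>" and min: "\<And>I. (I, M) \<in> ?r \<Longrightarrow> I \<notin> \<A>"
    by (rule wfE_min[OF _ assms(2)]) blast
  show ?thesis
  proof (rule that[OF M])
    fix I assume "I \<in> \<A>" "I \<subseteq> M"
    then show "I = M" using min[of I] M by blast
  qed
qed

context ring
begin

lemma self_in_principal_left_ideal:
  assumes "a \<in> carrier R"
  shows "a \<in> carrier R #> a"
proof -
  have "\<one> \<otimes> a \<in> carrier R #> a" unfolding r_coset_def by blast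
  then show ?thesis using assms by simp
qed

lemma left_ideal_principal:
  assumes "a \<in> carrier R"
  shows "left_ideal R (carrier R #> a)"
  unfolding left_ideal_def
proof (intro conjI ballI)
  show "additive_subgroup (carrier R #> a) R"
  proof (rule additive_subgroupI, rule add.subgroupI)
    show "carrier R #> a \<subseteq> carrier R" "carrier R #> a \<noteq> {}"
      using assms by (auto simp: r_coset_def)
    fix x y assume "x \<in> carrier R #> a" "y \<in> carrier R #> a"
    then obtain p q where pq: "p \<in> carrier R" "q \<in> carrier R" "x = p \<otimes> a" "y = q \<otimes> a"
      by (auto simp: r_coset_def)
    have "\<ominus> x = (\<ominus> p) \<otimes> a" "x \<oplus> y = (p \<oplus> q) \<otimes> a"
      using pq assms by (simp_all add: l_minus l_distr)
    then show "\<ominus> x \<in> carrier R #> a" "x \<oplus> y \<in> carrier R #> a"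
      using pq by (auto simp: r_coset_def)
  qed
next
  fix x y assume "x \<in> carrier R #> a" and y: "y \<in> carrier R"
  then obtain p where p: "p \<in> carrier R" "x = p \<otimes> a" by (auto simp: r_coset_def)
  then have "y \<otimes> x = (y \<otimes> p) \<otimes> a" using y assms by (simp add: m_assoc)
  then show "y \<otimes> x \<in> carrier R #> a" using p y by (auto simp: r_coset_def)
qed

text \<open>The kernel of a localization is a union of annihilators, one for every denominator. A denominator
\<open>s\<close> with minimal \<open>R s\<close> satisfies \<open>s \<in> R u s\<close> whenever \<open>u s\<close> is again a denominator, and by the Ore
condition every \<open>t \<in> S\<close> has a left multiple of the form \<open>u s\<close>; so whatever is killed by some \<open>t\<close> is
killed by \<open>s\<close>, and the union is a single annihilator.\<close>

lemma left_artinian_localization: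
  assumes art: "left_artinian R" and den: "left_denominator_set R S"
    and loc: "left_localization R S A \<alpha>"
  shows "\<alpha> ` carrier R = carrier A"
    and "\<exists>f\<in>carrier R. f \<otimes> f = f \<and> (\<forall>r\<in>carrier R. f \<otimes> r \<otimes> f = f \<otimes> r) \<and>
           a_kernel R A \<alpha> = {r \<in> carrier R. f \<otimes> r = \<zero>}"
proof -
  have A: "ring A" "\<alpha> \<in> ring_hom R A" using loc by (auto simp: left_localization_def)
  interpret h: ring_hom_ring R A \<alpha> using A ring_axioms by (simp add: ring_hom_ringI2)
  have S: "S \<subseteq> carrier R" by (rule left_denominator_set_subset[OF den])
  have mS: "submonoid S R" 
    using den by (auto simp: left_denominator_set_def left_ore_set_def multiplicative_set_def)
  have units: "\<And>s. s \<in> S \<Longrightarrow> \<alpha> s \<in> Units A" using loc by (simp add: left_localization_def)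
  have ker: "a_kernel R A \<alpha> = {r \<in> carrier R. \<exists>s\<in>S. s \<otimes> r = \<zero>}"
    using loc unfolding left_localization_def a_kernel_def' by blast
  \<comment> \<open>Stabilisation of the chain \<open>R s\<^sup>n\<close> gives \<open>s\<^sup>N = x s\<^sup>N\<^sup>+\<^sup>1\<close>; the unit \<open>\<alpha>(s)\<^sup>N\<close> is cancelled on the right.\<close>
  have inverse: "\<exists>x\<in>carrier R. \<alpha> x = inv\<^bsub>A\<^esub> \<alpha> s" if s: "s \<in> S" for s
  proof -
    have sc: "s \<in> carrier R" using s S by blast
    let ?I = "\<lambda>n::nat. carrier R #> (s [^] n)"
    have comm: "s \<otimes> s [^] n = s [^] n \<otimes> s" for n :: nat
      using nat_pow_Suc2[OF sc, of n] by simp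
    have "?I (Suc n) \<subseteq> ?I n" for n
    proof
      fix y assume "y \<in> ?I (Suc n)"
      then obtain x where "x \<in> carrier R" "y = x \<otimes> s [^] Suc n" by (auto simp: r_coset_def)
      then have "x \<otimes> s \<in> carrier R" "y = (x \<otimes> s) \<otimes> s [^] n"
        using sc by (simp_all add: m_assoc comm)
      then show "y \<in> ?I n" by (auto simp: r_coset_def)
    qed
    moreover have "\<And>n. left_ideal R (?I n)" using sc by (intro left_ideal_principal) simp
    ultimately obtain N where N: "\<forall>n\<ge>N. ?I n = ?I N"
      using art[unfolded left_artinian_def, rule_format, of ?I] by blast
    have "?I (Suc N) = ?I N" by (rule N[rule_format]) simp
    moreover have "s [^] N \<in> ?I N" using sc by (intro self_in_principal_left_ideal) simp
    ultimately obtain x where x: "x \<in> carrier R" "s [^] N = x \<otimes> s [^] Suc N"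
      by (auto simp: r_coset_def)
    have us: "\<alpha> s \<in> Units A" using units s by simp
    then have u: "\<alpha> s [^]\<^bsub>A\<^esub> N \<in> Units A" by (rule h.S.Units_pow_closed)
    have "s [^] N = (x \<otimes> s) \<otimes> s [^] N"
      using x sc by (simp add: m_assoc comm)
    then have "\<alpha> (s [^] N) = \<alpha> ((x \<otimes> s) \<otimes> s [^] N)" by simp
    then have "\<one>\<^bsub>A\<^esub> \<otimes>\<^bsub>A\<^esub> (\<alpha> s [^]\<^bsub>A\<^esub> N) = (\<alpha> x \<otimes>\<^bsub>A\<^esub> \<alpha> s) \<otimes>\<^bsub>A\<^esub> (\<alpha> s [^]\<^bsub>A\<^esub> N)"
      using x(1) sc by (simp add: h.hom_nat_pow)
    then have "(\<one>\<^bsub>A\<^esub> \<otimes>\<^bsub>A\<^esub> (\<alpha> s [^]\<^bsub>A\<^esub> N)) \<otimes>\<^bsub>A\<^esub> inv\<^bsub>A\<^esub> (\<alpha> s [^]\<^bsub>A\<^esub> N)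
       = ((\<alpha> x \<otimes>\<^bsub>A\<^esub> \<alpha> s) \<otimes>\<^bsub>A\<^esub> (\<alpha> s [^]\<^bsub>A\<^esub> N)) \<otimes>\<^bsub>A\<^esub> inv\<^bsub>A\<^esub> (\<alpha> s [^]\<^bsub>A\<^esub> N)" by simp
    then have "\<alpha> x \<otimes>\<^bsub>A\<^esub> \<alpha> s = \<one>\<^bsub>A\<^esub>"
      using u x(1) sc by (simp add: h.S.m_assoc)
    then have "inv\<^bsub>A\<^esub> \<alpha> s = (\<alpha> x \<otimes>\<^bsub>A\<^esub> \<alpha> s) \<otimes>\<^bsub>A\<^esub> inv\<^bsub>A\<^esub> \<alpha> s" using us by simp
    also have "\<dots> = \<alpha> x" using us x(1) sc by (simp add: h.S.m_assoc)
    finally have "\<alpha> x = inv\<^bsub>A\<^esub> \<alpha> s" by (rule sym)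
    then show ?thesis using x(1) by blast
  qed
  show "\<alpha> ` carrier R = carrier A"
  proof
    show "carrier A \<subseteq> \<alpha> ` carrier R"
    proof
      fix a assume "a \<in> carrier A"
      then obtain s r where sr: "s \<in> S" "r \<in> carrier R" "a = inv\<^bsub>A\<^esub> (\<alpha> s) \<otimes>\<^bsub>A\<^esub> \<alpha> r"
        using loc unfolding left_localization_def by blast
      then obtain x where "x \<in> carrier R" "\<alpha> x = inv\<^bsub>A\<^esub> \<alpha> s" using inverse by blast
      then have "x \<otimes> r \<in> carrier R" "a = \<alpha> (x \<otimes> r)" using sr by simp_all
      then show "a \<in> \<alpha> ` carrier R" by blast
    qed
  qed auto
  obtain s where s: "s \<in> S"
    and smin: "\<And>t. t \<in> S \<Longrightarrow> carrier R #> t \<subseteq> carrier R #> s \<Longrightarrow> carrier R #> t = carrier R #> s"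
  proof -
    have "carrier R #> \<one> \<in> (#>) (carrier R) ` S" using submonoid.one_closed[OF mS] by simp
    moreover have "\<And>I. I \<in> (#>) (carrier R) ` S \<Longrightarrow> left_ideal R I"
      using S left_ideal_principal by blast
    ultimately obtain M where M: "M \<in> (#>) (carrier R) ` S"
      and min: "\<And>I. I \<in> (#>) (carrier R) ` S \<Longrightarrow> I \<subseteq> M \<Longrightarrow> I = M"
      by (rule left_artinian_minimal[OF art]) blast+
    then obtain s where s: "s \<in> S" "M = carrier R #> s" by blast
    show ?thesis
    proof (rule that[OF s(1)])
      fix t assume "t \<in> S" "carrier R #> t \<subseteq> carrier R #> s"
      then show "carrier R #> t = carrier R #> s"
        using min[of "carrier R #> t"] unfolding s(2) by blast
    qed
  qed
  have sc: "s \<in> carrier R" using s S by blast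
  have recover: "\<exists>x\<in>carrier R. s = x \<otimes> (u \<otimes> s)" if u: "u \<in> carrier R" "u \<otimes> s \<in> S" for u
  proof -
    have "carrier R #> (u \<otimes> s) \<subseteq> carrier R #> s"
    proof
      fix y assume "y \<in> carrier R #> (u \<otimes> s)"
      then obtain x where "x \<in> carrier R" "y = x \<otimes> (u \<otimes> s)" by (auto simp: r_coset_def)
      then have "x \<otimes> u \<in> carrier R" "y = (x \<otimes> u) \<otimes> s" using u sc by (simp_all add: m_assoc)
      then show "y \<in> carrier R #> s" by (auto simp: r_coset_def)
    qed
    then have "carrier R #> (u \<otimes> s) = carrier R #> s" by (rule smin[OF u(2)])
    moreover have "s \<in> carrier R #> s" using sc by (rule self_in_principal_left_ideal)
    ultimately show ?thesis by (auto simp: r_coset_def)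
  qed
  have ann: "s \<otimes> r = \<zero>" if rk: "r \<in> a_kernel R A \<alpha>" for r
  proof -
    obtain t where t: "t \<in> S" "t \<otimes> r = \<zero>" and r: "r \<in> carrier R"
      using rk unfolding ker by blast
    have tc: "t \<in> carrier R" using t S by blast
    have "(S #> s) \<inter> (carrier R #> t) \<noteq> {}"
      using den sc t(1) by (simp add: left_denominator_set_def left_ore_set_def)
    then obtain u v where uv: "u \<in> S" "v \<in> carrier R" "u \<otimes> s = v \<otimes> t"
      by (auto simp: r_coset_def)
    have uc: "u \<in> carrier R" using uv S by blast
    have "u \<otimes> s \<in> S" using submonoid.m_closed[OF mS] uv(1) s by blast
    then obtain x where x: "x \<in> carrier R" "s = x \<otimes> (u \<otimes> s)" using recover uc by blast
    have "s \<otimes> r = (x \<otimes> (v \<otimes> t)) \<otimes> r" using x(2) uv(3) by simp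
    also have "\<dots> = x \<otimes> (v \<otimes> (t \<otimes> r))" using x(1) uv(2) tc r by (simp add: m_assoc)
    also have "\<dots> = \<zero>" using x(1) uv(2) t(2) by simp
    finally show ?thesis .
  qed
  obtain y where y: "y \<in> carrier R" "\<alpha> y = inv\<^bsub>A\<^esub> \<alpha> s" using inverse[OF s] by blast
  define f where "f = y \<otimes> s"
  have fc: "f \<in> carrier R" using y sc by (simp add: f_def)
  have \<alpha>f: "\<alpha> f = \<one>\<^bsub>A\<^esub>" using y sc units[OF s] by (simp add: f_def)
  \<comment> \<open>\<open>\<alpha>(f) = 1\<close> puts \<open>r f - r\<close> into the kernel, which \<open>s\<close> annihilates.\<close>
  have absorb: "s \<otimes> (r \<otimes> f) = s \<otimes> r" if r: "r \<in> carrier R" for r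
  proof -
    have "r \<otimes> f \<ominus> r \<in> a_kernel R A \<alpha>"
      using r fc \<alpha>f by (intro hom_eq_iff_minus_in_kernel[THEN iffD1]) (simp_all add: A ring_axioms)
    then have "s \<otimes> (r \<otimes> f \<ominus> r) = \<zero>" by (rule ann)
    then have "s \<otimes> (r \<otimes> f) \<ominus> s \<otimes> r = \<zero>"
      using r fc sc by (simp add: minus_eq r_distr r_minus)
    then show ?thesis using r fc sc by (simp add: r_right_minus_eq)
  qed
  have f_absorb: "f \<otimes> r \<otimes> f = f \<otimes> r" if r: "r \<in> carrier R" for r
    using absorb[OF r] r sc y(1) by (simp add: f_def m_assoc)
  have ff: "f \<otimes> f = f" using f_absorb[of \<one>] fc by simp
  have "a_kernel R A \<alpha> = {r \<in> carrier R. f \<otimes> r = \<zero>}"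
  proof
    show "a_kernel R A \<alpha> \<subseteq> {r \<in> carrier R. f \<otimes> r = \<zero>}"
    proof
      fix r assume r: "r \<in> a_kernel R A \<alpha>"
      then have rc: "r \<in> carrier R" unfolding ker by blast
      have "f \<otimes> r = y \<otimes> (s \<otimes> r)" using rc y(1) sc by (simp add: f_def m_assoc)
      also have "\<dots> = \<zero>" using ann[OF r] y(1) by simp
      finally show "r \<in> {r \<in> carrier R. f \<otimes> r = \<zero>}" using rc by simp
    qed
    show "{r \<in> carrier R. f \<otimes> r = \<zero>} \<subseteq> a_kernel R A \<alpha>"
    proof
      fix r assume "r \<in> {r \<in> carrier R. f \<otimes> r = \<zero>}"
      then have r: "r \<in> carrier R" "f \<otimes> r = \<zero>" by auto
      have "\<alpha> r = \<alpha> f \<otimes>\<^bsub>A\<^esub> \<alpha> r" using \<alpha>f r(1) by simp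
      also have "\<dots> = \<alpha> (f \<otimes> r)" using fc r(1) by simp
      also have "\<dots> = \<zero>\<^bsub>A\<^esub>" using r(2) by simp
      finally show "r \<in> a_kernel R A \<alpha>" unfolding a_kernel_def' using r(1) by blast
    qed
  qed
  then show "\<exists>f\<in>carrier R. f \<otimes> f = f \<and> (\<forall>r\<in>carrier R. f \<otimes> r \<otimes> f = f \<otimes> r) \<and>
           a_kernel R A \<alpha> = {r \<in> carrier R. f \<otimes> r = \<zero>}"
    using fc ff f_absorb by blast
qed

text \<open>Because \<open>e r = (e r) e\<close>, multiplication by \<open>e\<close> already solves the Ore problem for \<open>{1, e}\<close>, and
\<open>e\<close> becomes the identity modulo its annihilator.\<close>

lemma localization_at_idempotent:
  assumes e: "e \<in> carrier R" "e \<otimes> e = e" "e \<noteq> \<zero>" and abs: "\<And>r. r \<in> carrier R \<Longrightarrow> e \<otimes> r \<otimes> e = e \<otimes> r"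
    and A: "ring A" "\<alpha> \<in> ring_hom R A" "\<alpha> ` carrier R = carrier A"
    and ker: "a_kernel R A \<alpha> = {r \<in> carrier R. e \<otimes> r = \<zero>}"
  shows "left_denominator_set R {\<one>, e}" and "left_localization R {\<one>, e} A \<alpha>"
proof -
  interpret h: ring_hom_ring R A \<alpha> using A ring_axioms by (simp add: ring_hom_ringI2)
  have nz: "\<one> \<noteq> \<zero>" using e by (metis l_one l_null)
  have "submonoid {\<one>, e} R" by (rule submonoid.intro) (use e in auto)
  then have "multiplicative_set R {\<one>, e}"
    using nz e by (simp add: multiplicative_set_def)
  moreover have "({\<one>, e} #> r) \<inter> (carrier R #> s) \<noteq> {}" if "r \<in> carrier R" "s \<in> {\<one>, e}" for r s
  proof -
    have "e \<otimes> r \<in> ({\<one>, e} #> r)" by (auto simp: r_coset_def)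
    moreover have "e \<otimes> r = (e \<otimes> r) \<otimes> s" "e \<otimes> r \<in> carrier R" using that abs[of r] e by auto
    then have "e \<otimes> r \<in> carrier R #> s" by (auto simp: r_coset_def)
    ultimately show ?thesis by blast
  qed
  moreover have "\<exists>t\<in>{\<one>, e}. t \<otimes> r = \<zero>"
    if "r \<in> carrier R" "s \<in> {\<one>, e}" "r \<otimes> s = \<zero>" for r s
  proof -
    have "e \<otimes> r = (e \<otimes> r) \<otimes> s" using that abs[of r] e by auto
    also have "\<dots> = e \<otimes> (r \<otimes> s)" using that e by (auto simp: m_assoc)
    also have "\<dots> = \<zero>" using that(3) e by simp
    finally show ?thesis by blast
  qed
  ultimately show "left_denominator_set R {\<one>, e}"
    by (simp add: left_denominator_set_def left_ore_set_def)
  have "e \<ominus> \<one> \<in> a_kernel R A \<alpha>" using e ker by (simp add: minus_eq r_distr r_minus r_neg)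
  then have \<alpha>e: "\<alpha> e = \<one>\<^bsub>A\<^esub>"
    using hom_eq_iff_minus_in_kernel[OF ring_axioms A(1,2), of e \<one>] e by simp
  have "\<exists>s\<in>{\<one>, e}. \<exists>r\<in>carrier R. a = inv\<^bsub>A\<^esub> (\<alpha> s) \<otimes>\<^bsub>A\<^esub> \<alpha> r" if a: "a \<in> carrier A" for a
  proof -
    obtain r where "r \<in> carrier R" "a = \<alpha> r" using a A(3) by blast
    then have "a = inv\<^bsub>A\<^esub> (\<alpha> \<one>) \<otimes>\<^bsub>A\<^esub> \<alpha> r" by simp
    then show ?thesis using \<open>r \<in> carrier R\<close> by blast
  qed
  moreover have "\<alpha> r = \<zero>\<^bsub>A\<^esub> \<longleftrightarrow> (\<exists>s\<in>{\<one>, e}. s \<otimes> r = \<zero>)" if r: "r \<in> carrier R" for r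
  proof -
    have "\<alpha> r = \<zero>\<^bsub>A\<^esub> \<longleftrightarrow> r \<in> a_kernel R A \<alpha>" using r unfolding a_kernel_def' by blast
    also have "\<dots> \<longleftrightarrow> e \<otimes> r = \<zero>" using r unfolding ker by blast
    also have "\<dots> \<longleftrightarrow> (\<exists>s\<in>{\<one>, e}. s \<otimes> r = \<zero>)" using r e(1) by auto
    finally show ?thesis .
  qed
  moreover have "\<forall>s\<in>{\<one>, e}. \<alpha> s \<in> Units A" using \<alpha>e by simp
  ultimately show "left_localization R {\<one>, e} A \<alpha>"
    unfolding left_localization_def using A(1,2) by blast
qed

end


section \<open>Orthogonal idempotents\<close>

locale orthogonal_idempotents = ring R for R (structure) +
  fixes e :: "nat \<Rightarrow> 'a" and s :: nat
  assumes e_closed: "i < s \<Longrightarrow> e i \<in> carrier R"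
    and e_idem: "i < s \<Longrightarrow> e i \<otimes> e i = e i"
    and e_orth: "i < s \<Longrightarrow> j < s \<Longrightarrow> i \<noteq> j \<Longrightarrow> e i \<otimes> e j = \<zero>"
    and e_sum: "\<one> = (\<Oplus>i\<in>{..<s}. e i)"
begin

abbreviation E :: "nat set \<Rightarrow> 'a" where "E I \<equiv> idem_sum R e I"
abbreviation co :: "nat set \<Rightarrow> nat set" where "co I \<equiv> {..<s} - I"

lemma E_closed [simp]: "I \<subseteq> {..<s} \<Longrightarrow> E I \<in> carrier R"
  unfolding idem_sum_def by (rule finsum_closed) (auto intro: e_closed)

lemma E_empty [simp]: "E {} = \<zero>"
  by (simp add: idem_sum_def)

lemma E_insert:
  assumes "insert i I \<subseteq> {..<s}" "i \<notin> I"
  shows "E (insert i I) = e i \<oplus> E I"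
  unfolding idem_sum_def
  using assms by (intro finsum_insert) (auto intro: e_closed finite_subset[OF _ finite_lessThan])

lemma E_full: "E {..<s} = \<one>"
  using e_sum by (simp add: idem_sum_def)

lemma e_E:
  assumes i: "i < s" and I: "I \<subseteq> {..<s}"
  shows "e i \<otimes> E I = (if i \<in> I then e i else \<zero>)" and "E I \<otimes> e i = (if i \<in> I then e i else \<zero>)"
proof -
  have "finite I" using I finite_subset by blast
  then have "e i \<otimes> E I = (if i \<in> I then e i else \<zero>) \<and> E I \<otimes> e i = (if i \<in> I then e i else \<zero>)"
    using I
  proof (induction I)
    case empty
    then show ?case using i by (simp add: e_closed)
  next
    case (insert j I)
    then have j: "j < s" "I \<subseteq> {..<s}" by auto
    have "e i \<otimes> e j = (if i = j then e i else \<zero>)" "e j \<otimes> e i = (if i = j then e i else \<zero>)"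
      using i j e_idem e_orth by auto
    then show ?case
      using insert i j by (auto simp: E_insert r_distr l_distr e_closed)
  qed
  then show "e i \<otimes> E I = (if i \<in> I then e i else \<zero>)" "E I \<otimes> e i = (if i \<in> I then e i else \<zero>)"
    by auto
qed

text \<open>On subsets of the index set, \<open>I \<mapsto> E I\<close> turns intersections into products and complements into
\<open>1 - x\<close>: an embedded Boolean algebra of idempotents.\<close>

lemma E_mult:
  assumes I: "I \<subseteq> {..<s}" and K: "K \<subseteq> {..<s}"
  shows "E I \<otimes> E K = E (I \<inter> K)"
proof -
  have "finite I" using I finite_subset by blast
  then show ?thesis using I
  proof (induction I)
    case empty
    then show ?case using K by simp
  next
    case (insert j I)
    then have j: "j < s" "I \<subseteq> {..<s}" "I \<inter> K \<subseteq> {..<s}" by auto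
    have "E (insert j I) \<otimes> E K = (if j \<in> K then e j else \<zero>) \<oplus> E (I \<inter> K)"
      using insert j K by (simp add: E_insert l_distr e_closed e_E)
    also have "\<dots> = E (insert j I \<inter> K)"
      using insert j by (auto simp: Int_insert_left E_insert)
    finally show ?case .
  qed
qed

lemma E_add_co:
  assumes I: "I \<subseteq> {..<s}"
  shows "E I \<oplus> E (co I) = \<one>"
proof -
  have "E I \<oplus> E (co I) = E (I \<union> co I)"
    unfolding idem_sum_def using I
    by (intro finsum_Un_disjoint[symmetric]) (auto intro: e_closed finite_subset[OF _ finite_lessThan])
  also have "I \<union> co I = {..<s}" using I by blast
  finally show ?thesis by (simp add: E_full)
qed

lemma one_minus_E:
  assumes I: "I \<subseteq> {..<s}"
  shows "\<one> \<ominus> E I = E (co I)"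
proof -
  have "E (co I) \<oplus> E I = \<one>" using E_add_co[OF I] I by (simp add: a_comm)
  then have "\<one> \<ominus> E I = (E (co I) \<oplus> E I) \<ominus> E I" by simp
  also have "\<dots> = E (co I)" using I by (simp add: minus_eq a_assoc r_neg)
  finally show ?thesis .
qed

end

lemma finsum_opp_ring [simp]: "finsum (opp_ring R) f A = finsum R f A"
  by (simp add: finsum_def opp_ring_def)

lemma idem_sum_opp_ring [simp]: "idem_sum (opp_ring R) e I = idem_sum R e I"
  by (simp add: idem_sum_def)

lemma orthogonal_idempotents_opp:
  assumes "orthogonal_idempotents R e s"
  shows "orthogonal_idempotents (opp_ring R) e s"
proof -
  interpret orthogonal_idempotents R e s by fact
  show ?thesis
    by (intro orthogonal_idempotents.intro ring_opp_ring ring_axioms orthogonal_idempotents_axioms.intro)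
      (use e_closed e_idem e_orth e_sum in auto)
qed


section \<open>The Jacobson radical\<close>

context ring
begin

lemma left_idealD:
  assumes "left_ideal R I"
  shows "I \<subseteq> carrier R" "\<zero> \<in> I" "a \<in> I \<Longrightarrow> b \<in> I \<Longrightarrow> a \<oplus> b \<in> I"
    "a \<in> I \<Longrightarrow> r \<in> carrier R \<Longrightarrow> r \<otimes> a \<in> I"
proof -
  interpret additive_subgroup I R using assms by (simp add: left_ideal_def)
  show "I \<subseteq> carrier R" "\<zero> \<in> I" "a \<in> I \<Longrightarrow> b \<in> I \<Longrightarrow> a \<oplus> b \<in> I"
    using a_subset by auto
  show "a \<in> I \<Longrightarrow> r \<in> carrier R \<Longrightarrow> r \<otimes> a \<in> I"
    using assms by (simp add: left_ideal_def)
qed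

lemma left_idealI:
  assumes "I \<subseteq> carrier R" "\<zero> \<in> I" "\<And>a b. a \<in> I \<Longrightarrow> b \<in> I \<Longrightarrow> a \<oplus> b \<in> I"
    and mult: "\<And>a r. a \<in> I \<Longrightarrow> r \<in> carrier R \<Longrightarrow> r \<otimes> a \<in> I"
  shows "left_ideal R I"
  unfolding left_ideal_def
proof (intro conjI ballI)
  have "\<ominus> a \<in> I" if "a \<in> I" for a
  proof -
    have "\<ominus> a = (\<ominus> \<one>) \<otimes> a" using that assms(1) by (subst l_minus) auto
    then show ?thesis using mult[OF that, of "\<ominus> \<one>"] by simp
  qed
  then show "additive_subgroup I R"
    using assms by (intro additive_subgroupI add.subgroupI) auto
qed (use mult in auto)

lemma left_ideal_Inter:
  assumes "\<And>I. I \<in> \<A> \<Longrightarrow> left_ideal R I"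
  shows "left_ideal R (carrier R \<inter> \<Inter>\<A>)"
  using assms left_idealD by (intro left_idealI) auto

lemma left_ideal_eq_carrier:
  assumes "left_ideal R I" "\<one> \<in> I"
  shows "I = carrier R"
proof
  show "carrier R \<subseteq> I" using left_idealD(4)[OF assms] by auto
qed (rule left_idealD(1)[OF assms(1)])

lemma left_ideal_Union_chain:
  assumes "\<C> \<noteq> {}" "\<And>I. I \<in> \<C> \<Longrightarrow> left_ideal R I" "\<And>I K. I \<in> \<C> \<Longrightarrow> K \<in> \<C> \<Longrightarrow> I \<subseteq> K \<or> K \<subseteq> I"
  shows "left_ideal R (\<Union>\<C>)"
proof (rule left_idealI)
  show "\<Union>\<C> \<subseteq> carrier R" using left_idealD(1) assms(2) by blast
  show "\<zero> \<in> \<Union>\<C>" using left_idealD(2) assms(1,2) by blast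
  show "r \<otimes> a \<in> \<Union>\<C>" if "a \<in> \<Union>\<C>" "r \<in> carrier R" for a r
    using left_idealD(4) assms(2) that by blast
  fix a b assume "a \<in> \<Union>\<C>" "b \<in> \<Union>\<C>"
  then obtain I K where "I \<in> \<C>" "K \<in> \<C>" "a \<in> I" "b \<in> K" by blast
  then have "\<exists>H\<in>\<C>. a \<in> H \<and> b \<in> H" using assms(3) by blast
  then show "a \<oplus> b \<in> \<Union>\<C>" using left_idealD(3) assms(2) by blast
qed

lemma maximal_left_ideal_above:
  assumes "left_ideal R I" "\<one> \<notin> I"
  obtains M where "maximal_left_ideal R M" "I \<subseteq> M" "\<one> \<notin> M"
proof -
  let ?A = "{K. left_ideal R K \<and> I \<subseteq> K \<and> \<one> \<notin> K}"
  have "\<exists>M\<in>?A. \<forall>K\<in>?A. M \<subseteq> K \<longrightarrow> K = M"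
  proof (rule subset_Zorn_nonempty)
    show "?A \<noteq> {}" using assms by blast
    fix \<C> assume \<C>: "\<C> \<noteq> {}" "subset.chain ?A \<C>"
    then have "left_ideal R (\<Union>\<C>)"
      by (intro left_ideal_Union_chain) (auto simp: subset.chain_def)
    then show "\<Union>\<C> \<in> ?A" using \<C> by (auto simp: subset.chain_def)
  qed
  then obtain M where M: "left_ideal R M" "I \<subseteq> M" "\<one> \<notin> M"
    and max: "\<And>K. left_ideal R K \<Longrightarrow> \<one> \<notin> K \<Longrightarrow> M \<subseteq> K \<Longrightarrow> K = M" by auto
  have "K = M \<or> K = carrier R" if "left_ideal R K" "M \<subseteq> K" for K
    using max that left_ideal_eq_carrier by blast
  then have "maximal_left_ideal R M"
    using M by (auto simp: maximal_left_ideal_def)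
  then show ?thesis using M that by blast
qed

text \<open>The set is the annihilator of the class of \<open>r\<close> in the simple module \<open>R/M\<close>. If a left ideal \<open>K\<close> is
larger, then \<open>M + K r = R\<close>, and writing \<open>r\<close> in this sum exhibits \<open>1\<close> in \<open>K\<close>. This is what makes the
intersection of all maximal left ideals stable under right multiplication.\<close>

lemma maximal_left_ideal_colon:
  assumes M: "maximal_left_ideal R M" and r: "r \<in> carrier R" "r \<notin> M"
  shows "maximal_left_ideal R {y \<in> carrier R. y \<otimes> r \<in> M}"
proof -
  let ?L = "{y \<in> carrier R. y \<otimes> r \<in> M}"
  have lM: "left_ideal R M" using M by (simp add: maximal_left_ideal_def)
  note D = left_idealD[OF lM]
  have lL: "left_ideal R ?L"
    using D r by (intro left_idealI) (auto simp: l_distr m_assoc)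
  have "\<one> \<notin> ?L" using r by simp
  then have ne: "?L \<noteq> carrier R" by (metis one_closed)
  have "K = ?L \<or> K = carrier R" if K: "left_ideal R K" "?L \<subseteq> K" for K
  proof (cases "K \<subseteq> ?L")
    case False
    then obtain k where k: "k \<in> K" "k \<otimes> r \<notin> M" using left_idealD(1)[OF K(1)] by auto
    note DK = left_idealD[OF K(1)]
    let ?N = "{m \<oplus> y \<otimes> r | m y. m \<in> M \<and> y \<in> K}"
    have "left_ideal R ?N"
    proof (rule left_idealI)
      show "?N \<subseteq> carrier R" using D(1) DK(1) r(1) by auto
      have "\<zero> = \<zero> \<oplus> \<zero> \<otimes> r" using r by simp
      then show "\<zero> \<in> ?N" using D(2) DK(2) by blast
    next
      fix a b assume "a \<in> ?N" "b \<in> ?N"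
      then obtain m y m' y' where 1: "m \<in> M" "y \<in> K" "a = m \<oplus> y \<otimes> r" 
        "m' \<in> M" "y' \<in> K" "b = m' \<oplus> y' \<otimes> r" by blast
      then have "m \<in> carrier R" "y \<in> carrier R" "m' \<in> carrier R" "y' \<in> carrier R"
        using D(1) DK(1) by auto
      then have "a \<oplus> b = (m \<oplus> m') \<oplus> (y \<oplus> y') \<otimes> r" 
        using 1 r by (simp add: l_distr a_ac)
      then show "a \<oplus> b \<in> ?N" using 1 D(3) DK(3) by blast
    next
      fix a x assume "a \<in> ?N" and x: "x \<in> carrier R"
      then obtain m y where 1: "m \<in> M" "y \<in> K" "a = m \<oplus> y \<otimes> r" by blast
      then have "m \<in> carrier R" "y \<in> carrier R" using D(1) DK(1) by auto
      then have "x \<otimes> a = x \<otimes> m \<oplus> (x \<otimes> y) \<otimes> r" using 1 r x by (simp add: r_distr m_assoc)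
      then show "x \<otimes> a \<in> ?N" using 1 x D(4) DK(4) by blast
    qed
    moreover have "M \<subseteq> ?N"
    proof
      fix m assume "m \<in> M"
      then have "m = m \<oplus> \<zero> \<otimes> r" using D(1) r by auto
      then show "m \<in> ?N" using \<open>m \<in> M\<close> DK(2) by blast
    qed
    moreover have "?N \<noteq> M"
    proof -
      have "\<zero> \<oplus> k \<otimes> r \<in> ?N" using k D(2) by blast
      moreover have "\<zero> \<oplus> k \<otimes> r = k \<otimes> r" using k r DK(1) by auto
      ultimately show ?thesis using k by auto
    qed
    ultimately have "?N = carrier R" using M unfolding maximal_left_ideal_def by blast
    then obtain m y where 1: "m \<in> M" "y \<in> K" "r = m \<oplus> y \<otimes> r" using r(1) by blast
    then have c: "m \<in> carrier R" "y \<in> carrier R" using D(1) DK(1) by auto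
    have "(\<one> \<ominus> y) \<otimes> r = r \<ominus> y \<otimes> r" using c r by (simp add: minus_eq l_distr l_minus)
    also have "\<dots> = (m \<oplus> y \<otimes> r) \<ominus> y \<otimes> r" using 1 by simp
    also have "\<dots> = m" using c r by (simp add: minus_eq a_assoc r_neg)
    finally have "\<one> \<ominus> y \<in> ?L" using 1 c by simp
    then have "(\<one> \<ominus> y) \<oplus> y \<in> K" using K(2) 1(2) DK(3) by blast
    moreover have "(\<one> \<ominus> y) \<oplus> y = \<one>" using c by (simp add: minus_eq a_assoc l_neg)
    ultimately show ?thesis using left_ideal_eq_carrier[OF K(1)] by simp
  qed (use K in blast)
  then show ?thesis using lL ne by (auto simp: maximal_left_ideal_def)
qed

lemma jacobson_radical_ideal: "ideal (jacobson_radical R) R"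
proof -
  have left: "left_ideal R (jacobson_radical R)"
    unfolding jacobson_radical_def
    by (rule left_ideal_Inter) (simp add: maximal_left_ideal_def)
  note D = left_idealD[OF left]
  show ?thesis
  proof (rule idealI[OF ring_axioms])
    show "subgroup (jacobson_radical R) (add_monoid R)"
      using left by (simp add: left_ideal_def additive_subgroup.a_subgroup)
    fix a r assume a: "a \<in> jacobson_radical R" and r: "r \<in> carrier R"
    show "r \<otimes> a \<in> jacobson_radical R" using D(4) a r .
    have ac: "a \<in> carrier R" using a by (simp add: jacobson_radical_def)
    have "a \<otimes> r \<in> M" if M: "maximal_left_ideal R M" for M
    proof (cases "r \<in> M")
      case True
      then show ?thesis
        using left_idealD(4)[of M r a] M ac by (simp add: maximal_left_ideal_def)
    next
      case False
      then have "a \<in> {y \<in> carrier R. y \<otimes> r \<in> M}"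
        using maximal_left_ideal_colon[OF M r] a by (auto simp: jacobson_radical_def)
      then show ?thesis by simp
    qed
    then show "a \<otimes> r \<in> jacobson_radical R" using ac r by (simp add: jacobson_radical_def)
  qed
qed

text \<open>For an idempotent \<open>x \<noteq> 0\<close> the left ideal \<open>R (1 - x)\<close> is proper, and a maximal left ideal above it
cannot contain \<open>x\<close>.\<close>

lemma idempotent_in_radical:
  assumes x: "x \<in> jacobson_radical R" and xx: "x \<otimes> x = x"
  shows "x = \<zero>"
proof (rule ccontr)
  assume nz: "x \<noteq> \<zero>"
  have xc: "x \<in> carrier R" using x by (simp add: jacobson_radical_def)
  have "\<one> \<notin> carrier R #> (\<one> \<ominus> x)"
  proof
    assume "\<one> \<in> carrier R #> (\<one> \<ominus> x)"
    then obtain r where r: "r \<in> carrier R" "\<one> = r \<otimes> (\<one> \<ominus> x)" by (auto simp: r_coset_def)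
    have "(\<one> \<ominus> x) \<otimes> x = \<zero>" using xc xx by (simp add: minus_eq l_distr l_minus r_neg)
    then have "r \<otimes> (\<one> \<ominus> x) \<otimes> x = \<zero>" using r(1) xc by (simp add: m_assoc)
    then show False using r(2) xc nz by simp
  qed
  then obtain M where M: "maximal_left_ideal R M" "carrier R #> (\<one> \<ominus> x) \<subseteq> M" "\<one> \<notin> M"
    using maximal_left_ideal_above left_ideal_principal xc by (metis minus_closed one_closed)
  have "\<one> \<otimes> (\<one> \<ominus> x) \<in> carrier R #> (\<one> \<ominus> x)" unfolding r_coset_def by blast
  then have "\<one> \<ominus> x \<in> M" using M(2) xc by auto
  moreover have "x \<in> M" using x M(1) by (auto simp: jacobson_radical_def)
  ultimately have "(\<one> \<ominus> x) \<oplus> x \<in> M"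
    using M(1) left_idealD(3) by (auto simp: maximal_left_ideal_def)
  then show False using M(3) xc by (simp add: minus_eq a_assoc l_neg)
qed

end


section \<open>Right semicentral idempotents modulo the radical\<close>

context ring
begin

text \<open>The elements \<open>y\<close> with \<open>f R y = 0\<close> form a two-sided ideal that contains \<open>1 - f\<close>. If this ideal is
zero then \<open>f = 1\<close>, and if it is everything then \<open>f = 0\<close>.\<close>

lemma semicentral_idempotent_of_simple:
  assumes simple: "\<And>I. ideal I R \<Longrightarrow> I = {\<zero>} \<or> I = carrier R"
    and f: "f \<in> carrier R" and abs: "\<And>r. r \<in> carrier R \<Longrightarrow> f \<otimes> r \<otimes> f = f \<otimes> r"
  shows "f = \<zero> \<or> f = \<one>"
proof -
  let ?I = "{y \<in> carrier R. \<forall>r\<in>carrier R. f \<otimes> r \<otimes> y = \<zero>}"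
  have "ideal ?I R"
  proof (rule idealI[OF ring_axioms])
    show "subgroup ?I (add_monoid R)"
      using f by (intro add.subgroupI) (auto simp: r_distr r_minus)
    fix a x assume a: "a \<in> ?I" and x: "x \<in> carrier R"
    have "f \<otimes> r \<otimes> (x \<otimes> a) = f \<otimes> (r \<otimes> x) \<otimes> a" if "r \<in> carrier R" for r
      using that a x f by (simp add: m_assoc)
    then show "x \<otimes> a \<in> ?I" using a x by simp
    have "f \<otimes> r \<otimes> (a \<otimes> x) = (f \<otimes> r \<otimes> a) \<otimes> x" if "r \<in> carrier R" for r
      using that a x f by (simp add: m_assoc)
    then show "a \<otimes> x \<in> ?I" using a x by simp
  qed
  then consider "?I = {\<zero>}" | "?I = carrier R" using simple by blast
  then show ?thesis
  proof cases
    case 1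
    have "f \<otimes> r \<otimes> (\<one> \<ominus> f) = \<zero>" if "r \<in> carrier R" for r
      using that f abs[OF that] by (simp add: minus_eq r_distr r_minus r_neg)
    then have "\<one> \<ominus> f \<in> ?I" using f by simp
    then show ?thesis using 1 f by (simp add: r_right_minus_eq)
  next
    case 2
    then have "f \<otimes> \<one> \<otimes> \<one> = \<zero>" using one_closed by blast
    then show ?thesis using f by simp
  qed
qed

end

lemma RDirProd_list_coordinate_hom:
  assumes "i < length Rs"
  shows "(\<lambda>xs. xs ! i) \<in> ring_hom (RDirProd_list Rs) (Rs ! i)"
  using assms
proof (induction Rs arbitrary: i)
  case (Cons T Rs)
  have cons: "(x # xs) \<otimes>\<^bsub>RDirProd_list (T # Rs)\<^esub> (y # ys) = (x \<otimes>\<^bsub>T\<^esub> y) # (xs \<otimes>\<^bsub>RDirProd_list Rs\<^esub> ys)"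
    "(x # xs) \<oplus>\<^bsub>RDirProd_list (T # Rs)\<^esub> (y # ys) = (x \<oplus>\<^bsub>T\<^esub> y) # (xs \<oplus>\<^bsub>RDirProd_list Rs\<^esub> ys)"
    if "x \<in> carrier T" "y \<in> carrier T" "xs \<in> carrier (RDirProd_list Rs)" "ys \<in> carrier (RDirProd_list Rs)"
    for x y xs ys
    using ring_hom_memE(2,3)[OF RDirProd_list_hom1, of "(x, xs)" T Rs "(y, ys)"] that
    by (auto simp: RDirProd_def DirProd_def monoid.defs)
  show ?case
  proof (cases i)
    case 0
    show ?thesis unfolding 0
      by (rule ring_hom_memI) (auto simp: RDirProd_list_carrier RDirProd_list_one cons)
  next
    case (Suc j)
    then have j: "(\<lambda>xs. xs ! j) \<in> ring_hom (RDirProd_list Rs) (Rs ! j)" using Cons by simp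
    show ?thesis unfolding Suc
      using ring_hom_memE[OF j]
      by (intro ring_hom_memI) (auto simp: RDirProd_list_carrier RDirProd_list_one cons)
  qed
qed simp

text \<open>Each coordinate of the image of \<open>f\<close> in the product is right semicentral in a simple ring, hence \<open>0\<close>
or \<open>1\<close>; \<open>I\<close> collects the coordinates equal to \<open>1\<close>.\<close>

lemma (in orthogonal_idempotents) semicentral_idempotent_mod_ideal:
  assumes J: "ideal J R" and len: "length Rs = s"
    and simple: "\<And>i. i < s \<Longrightarrow> simple_artinian (Rs ! i)"
    and \<psi>: "\<psi> \<in> ring_iso (R Quot J) (RDirProd_list Rs)"
    and \<psi>e: "\<And>i. i < s \<Longrightarrow> \<psi> (J +> e i) = factor_one Rs i"
    and f: "f \<in> carrier R" and abs: "\<And>r. r \<in> carrier R \<Longrightarrow> f \<otimes> r \<otimes> f = f \<otimes> r"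
  shows "\<exists>I\<subseteq>{..<s}. J +> f = J +> E I"
proof -
  define c where "c i r = \<psi> (J +> r) ! i" for i r
  note q = quotient_map_properties[OF J]
  have \<psi>_hom: "\<psi> \<in> ring_hom (R Quot J) (RDirProd_list Rs)"
    and \<psi>_bij: "bij_betw \<psi> (carrier (R Quot J)) (carrier (RDirProd_list Rs))"
    using \<psi> by (auto simp: ring_iso_def)
  have \<psi>r: "\<psi> (J +> r) \<in> carrier (RDirProd_list Rs)" if "r \<in> carrier R" for r
    using that q(1) \<psi>_hom by (meson ring_hom_closed)
  have ring: "ring (Rs ! i)" if "i < s" for i using simple that by (simp add: simple_artinian_def)
  have c_hom: "c i \<in> ring_hom R (Rs ! i)" if "i < s" for i
    using ring_hom_trans[OF ring_hom_trans[OF q(1) \<psi>_hom] RDirProd_list_coordinate_hom, of i] that len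
    by (simp add: comp_def c_def[abs_def])
  have c_surj: "\<exists>r\<in>carrier R. c i r = x" if i: "i < s" and x: "x \<in> carrier (Rs ! i)" for i x
  proof -
    \<comment> \<open>the element of the product concentrated in coordinate \<open>i\<close>\<close>
    let ?w = "map (\<lambda>j. if j = i then x else \<zero>\<^bsub>Rs ! j\<^esub>) [0..<s]"
    have "?w \<in> carrier (RDirProd_list Rs)"
    proof (rule RDirProd_list_carrier_memI)
      fix k assume "k < length Rs"
      then show "?w ! k \<in> carrier (Rs ! k)"
        using x len ring[of k] by (simp add: ring.ring_simprules(2))
    qed (simp add: len)
    then have "?w \<in> \<psi> ` (\<lambda>r. J +> r) ` carrier R"
      using \<psi>_bij q(2) by (simp add: bij_betw_def)
    then obtain r where "r \<in> carrier R" "\<psi> (J +> r) = ?w" by force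
    then show ?thesis using i by (intro bexI[of _ r]) (simp_all add: c_def)
  qed
  have c_e: "c i (e j) = (if i = j then \<one>\<^bsub>Rs ! i\<^esub> else \<zero>\<^bsub>Rs ! i\<^esub>)" if "i < s" "j < s" for i j
    using \<psi>e[OF that(2)] that len by (simp add: c_def factor_one_def)
  have f01: "c i f = \<zero>\<^bsub>Rs ! i\<^esub> \<or> c i f = \<one>\<^bsub>Rs ! i\<^esub>" if i: "i < s" for i
  proof (rule ring.semicentral_idempotent_of_simple[OF ring[OF i]])
    show "I = {\<zero>\<^bsub>Rs ! i\<^esub>} \<or> I = carrier (Rs ! i)" if "ideal I (Rs ! i)" for I
      using simple[OF i] that by (simp add: simple_artinian_def)
    show "c i f \<in> carrier (Rs ! i)" using ring_hom_closed[OF c_hom[OF i] f] .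
    fix x assume "x \<in> carrier (Rs ! i)"
    then obtain r where r: "r \<in> carrier R" "x = c i r" using c_surj i by blast
    have "c i (f \<otimes> r \<otimes> f) = c i (f \<otimes> r)" using abs r by simp
    then show "c i f \<otimes>\<^bsub>Rs ! i\<^esub> x \<otimes>\<^bsub>Rs ! i\<^esub> c i f = c i f \<otimes>\<^bsub>Rs ! i\<^esub> x"
      using r f by (simp add: ring_hom_mult[OF c_hom[OF i]])
  qed
  define I where "I = {i. i < s \<and> c i f = \<one>\<^bsub>Rs ! i\<^esub>}"
  have I: "I \<subseteq> {..<s}" by (auto simp: I_def)
  have cEI: "c i (E I) = c i f" if i: "i < s" for i
  proof -
    interpret T: ring "Rs ! i" using ring[OF i] .
    have Ec: "c i (E I) \<in> carrier (Rs ! i)" using ring_hom_closed[OF c_hom[OF i]] I by simp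
    have "c i (e i \<otimes> E I) = c i (e i) \<otimes>\<^bsub>Rs ! i\<^esub> c i (E I)"
      using i I by (simp add: ring_hom_mult[OF c_hom[OF i]] e_closed)
    also have "\<dots> = c i (E I)" using c_e[OF i i] Ec by simp
    finally have "c i (E I) = c i (if i \<in> I then e i else \<zero>)" using e_E(1)[OF i I] by simp
    also have "\<dots> = (if i \<in> I then \<one>\<^bsub>Rs ! i\<^esub> else \<zero>\<^bsub>Rs ! i\<^esub>)"
      using c_e[OF i i] ring_hom_zero[OF c_hom[OF i] ring_axioms ring[OF i]] by simp
    also have "\<dots> = c i f" using f01[OF i] i by (auto simp: I_def)
    finally show ?thesis .
  qed
  have "\<psi> (J +> f) = \<psi> (J +> E I)"
  proof (rule nth_equalityI)
    show "length (\<psi> (J +> f)) = length (\<psi> (J +> E I))"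
      using RDirProd_list_carrier_mem(1)[OF \<psi>r[OF f]]
        RDirProd_list_carrier_mem(1)[OF \<psi>r[OF E_closed[OF I]]] by simp
    fix i assume "i < length (\<psi> (J +> f))"
    then have "i < s" using RDirProd_list_carrier_mem(1)[OF \<psi>r[OF f]] len by simp
    then show "\<psi> (J +> f) ! i = \<psi> (J +> E I) ! i" using cEI by (simp add: c_def)
  qed
  moreover have "J +> r \<in> carrier (R Quot J)" if "r \<in> carrier R" for r
    using ring_hom_closed[OF q(1) that] .
  ultimately have "J +> f = J +> E I"
    using inj_onD[OF bij_betw_imp_inj_on[OF \<psi>_bij]] f E_closed[OF I] by blast
  then show ?thesis using I by blast
qed


section \<open>Idempotents lifted modulo an ideal\<close>

lemma (in ring) minus_diff_swap:
  assumes "a \<in> carrier R" "b \<in> carrier R" "c \<in> carrier R"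
  shows "(a \<ominus> b) \<ominus> (a \<ominus> c) = c \<ominus> b"
proof -
  have "(a \<ominus> b) \<ominus> (a \<ominus> c) = (\<ominus> b \<oplus> a) \<oplus> (\<ominus> a \<oplus> c)"
    using assms by (simp add: minus_eq minus_add a_comm)
  also have "\<dots> = \<ominus> b \<oplus> (a \<oplus> (\<ominus> a \<oplus> c))" using assms by (simp add: a_assoc)
  also have "\<dots> = c \<ominus> b" using assms by (simp add: r_neg2) (simp add: minus_eq a_comm)
  finally show ?thesis .
qed

text \<open>What the semisimple quotient contributes to the classification. The last condition speaks of right
semicentral idempotents only, but replacing \<open>f\<close> by \<open>1 - f\<close> gives the left version, so that the
locale passes to the opposite ring; see \<open>lifted_idempotents_opp\<close>.\<close>

locale lifted_idempotents = orthogonal_idempotents +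
  fixes J :: "'a set"
  assumes J_ideal: "ideal J R"
    and J_idempotent: "x \<in> J \<Longrightarrow> x \<otimes> x = x \<Longrightarrow> x = \<zero>"
    and e_nonzero: "i < s \<Longrightarrow> e i \<noteq> \<zero>"
    and one_nonzero: "\<one> \<noteq> \<zero>"
    and semicentral_lift: "\<lbrakk>f \<in> carrier R; f \<otimes> f = f; \<And>r. r \<in> carrier R \<Longrightarrow> f \<otimes> r \<otimes> f = f \<otimes> r\<rbrakk>
       \<Longrightarrow> \<exists>I\<subseteq>{..<s}. J +> f = J +> E I"
begin

text \<open>Put \<open>u = e\<^sub>I\<close>, \<open>h = 1 - u\<close>, \<open>k = 1 - f\<close>, so that \<open>h - k = f - u \<in> J\<close>. The products \<open>f h = f (h - k)\<close> and
\<open>u k = - u (h - k)\<close> lie in \<open>J\<close> and are idempotent, hence zero. Thus \<open>k h = h\<close> and \<open>h k = k\<close>, that is,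
\<open>h R = k R\<close>.\<close>

lemma kernel_of_congruent_idempotent:
  assumes f: "f \<in> carrier R" "f \<otimes> f = f" and abs: "\<And>r. r \<in> carrier R \<Longrightarrow> f \<otimes> r \<otimes> f = f \<otimes> r"
    and I: "I \<subseteq> {..<s}" and cong: "J +> f = J +> E I"
  shows "{r \<in> carrier R. f \<otimes> r = \<zero>} = E (co I) <# carrier R"
    and "\<And>r. r \<in> carrier R \<Longrightarrow> E I \<otimes> r \<otimes> E (co I) = \<zero>"
proof -
  interpret J: ideal J R by (rule J_ideal)
  define u where "u = E I"
  define h where "h = E (co I)"
  define k where "k = \<one> \<ominus> f"
  have c [simp]: "u \<in> carrier R" "h \<in> carrier R" "k \<in> carrier R" "f \<in> carrier R"
    using I f by (auto simp: u_def h_def k_def)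
  have hh: "h \<otimes> h = h" and uh: "u \<otimes> h = \<zero>"
    using I by (simp_all add: h_def u_def E_mult Diff_Int_distrib2)
  have h1: "h = \<one> \<ominus> u" using one_minus_E[OF I] by (simp add: u_def h_def)
  have u1: "u = \<one> \<ominus> h"
    using one_minus_E[of "co I"] I by (simp add: u_def h_def double_diff)
  have fk: "f \<otimes> k = \<zero>" using f by (simp add: k_def minus_eq r_distr r_minus r_neg)
  have kk: "k \<otimes> k = k" using f fk by (simp add: k_def minus_eq l_distr l_minus)
  have fu: "f \<ominus> u \<in> J"
    using cong f(1) c quotient_eq_iff_same_a_r_cos[OF J_ideal] by (simp add: u_def)
  have hk: "h \<ominus> k = f \<ominus> u"
    using minus_diff_swap[of \<one> u f] by (simp add: h1 k_def)
  have fh: "f \<otimes> h = \<zero>"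
  proof (rule J_idempotent)
    have "f \<otimes> h = f \<otimes> (h \<ominus> k)" using fk by (simp add: minus_eq r_distr r_minus)
    then show "f \<otimes> h \<in> J" using fu hk J.I_l_closed by simp
    have "f \<otimes> h \<otimes> (f \<otimes> h) = (f \<otimes> h \<otimes> f) \<otimes> h" by (simp add: m_assoc)
    also have "\<dots> = f \<otimes> h" using abs[of h] hh by (simp add: m_assoc)
    finally show "f \<otimes> h \<otimes> (f \<otimes> h) = f \<otimes> h" .
  qed
  then have kh: "k \<otimes> h = h" by (simp add: k_def minus_eq l_distr l_minus)
  have uk: "u \<otimes> k = \<zero>"
  proof (rule J_idempotent)
    have "\<ominus> (u \<otimes> (h \<ominus> k)) = u \<otimes> k"
      using uh by (simp add: minus_eq r_distr r_minus)
    moreover have "\<ominus> (u \<otimes> (h \<ominus> k)) \<in> J"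
      unfolding hk by (intro J.a_inv_closed J.I_l_closed fu) simp
    ultimately show "u \<otimes> k \<in> J" by simp
    have "k \<otimes> u \<otimes> k = (k \<ominus> k \<otimes> h) \<otimes> k" by (simp add: u1 minus_eq r_distr r_minus)
    also have "\<dots> = k \<ominus> h \<otimes> k" using kh kk by (simp add: minus_eq l_distr l_minus)
    also have "\<dots> = u \<otimes> k" by (simp add: u1 minus_eq l_distr l_minus)
    finally have *: "k \<otimes> u \<otimes> k = u \<otimes> k" .
    have "u \<otimes> u = u" using I by (simp add: u_def E_mult)
    have "u \<otimes> k \<otimes> (u \<otimes> k) = u \<otimes> (k \<otimes> u \<otimes> k)" by (simp add: m_assoc)
    also have "\<dots> = u \<otimes> (u \<otimes> k)" unfolding * by simp
    also have "\<dots> = u \<otimes> k" using \<open>u \<otimes> u = u\<close> by (simp add: m_assoc[symmetric])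
    finally show "u \<otimes> k \<otimes> (u \<otimes> k) = u \<otimes> k" .
  qed
  have hk': "h \<otimes> k = k" using uk by (simp add: h1 minus_eq l_distr l_minus)
  have k_fix: "k \<otimes> r = r" if "r \<in> carrier R" "f \<otimes> r = \<zero>" for r
    using that by (simp add: k_def minus_eq l_distr l_minus)
  have h_fix: "h \<otimes> r = r" if "r \<in> carrier R" "f \<otimes> r = \<zero>" for r
  proof -
    have "h \<otimes> r = h \<otimes> k \<otimes> r" using k_fix[OF that] that(1) by (simp add: m_assoc)
    then show ?thesis using hk' k_fix[OF that] by simp
  qed
  show "{r \<in> carrier R. f \<otimes> r = \<zero>} = E (co I) <# carrier R"
  proof
    show "{r \<in> carrier R. f \<otimes> r = \<zero>} \<subseteq> E (co I) <# carrier R"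
    proof
      fix r assume "r \<in> {r \<in> carrier R. f \<otimes> r = \<zero>}"
      then have r: "r \<in> carrier R" "r = h \<otimes> r" using h_fix by auto
      then show "r \<in> E (co I) <# carrier R" unfolding l_coset_def h_def by blast
    qed
    show "E (co I) <# carrier R \<subseteq> {r \<in> carrier R. f \<otimes> r = \<zero>}"
    proof
      fix x assume "x \<in> E (co I) <# carrier R"
      then obtain r where r: "r \<in> carrier R" "x = h \<otimes> r" by (auto simp: l_coset_def h_def)
      have "f \<otimes> x = f \<otimes> h \<otimes> r" using r by (simp add: m_assoc)
      then show "x \<in> {r \<in> carrier R. f \<otimes> r = \<zero>}" using r fh by simp
    qed
  qed
  show "E I \<otimes> r \<otimes> E (co I) = \<zero>" if r: "r \<in> carrier R" for r
  proof -
    have "f \<otimes> (r \<otimes> h) = (f \<otimes> r \<otimes> f) \<otimes> h" using abs[OF r] r by (simp add: m_assoc)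
    also have "\<dots> = f \<otimes> r \<otimes> (f \<otimes> h)" using r by (simp add: m_assoc)
    also have "\<dots> = \<zero>" using fh r by simp
    finally have "h \<otimes> (r \<otimes> h) = r \<otimes> h" using h_fix r by simp
    then have "u \<otimes> (r \<otimes> h) = u \<otimes> (h \<otimes> (r \<otimes> h))" by simp
    also have "\<dots> = u \<otimes> h \<otimes> (r \<otimes> h)" using r by (simp add: m_assoc)
    also have "\<dots> = \<zero>" using uh r by simp
    finally show ?thesis using r I by (simp add: u_def h_def m_assoc)
  qed
qed

text \<open>The full index set is included on purpose: it corresponds to the kernel \<open>0\<close>, that is, to the
class of \<open>R\<close> itself.\<close>

definition splittings :: "nat set set" where
  "splittings = {I. I \<noteq> {} \<and> I \<subseteq> {..<s} \<and> (\<forall>r\<in>carrier R. E I \<otimes> r \<otimes> E (co I) = \<zero>)}"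

lemma splittingsD:
  assumes "I \<in> splittings"
  shows "I \<noteq> {}" "I \<subseteq> {..<s}" "r \<in> carrier R \<Longrightarrow> E I \<otimes> r \<otimes> E (co I) = \<zero>"
  using assms by (auto simp: splittings_def)

lemma E_nonzero:
  assumes "I \<subseteq> {..<s}" "I \<noteq> {}"
  shows "E I \<noteq> \<zero>"
proof -
  obtain i where i: "i \<in> I" "i < s" using assms by blast
  then have "e i \<otimes> E I = e i" using e_E(1) assms(1) by simp
  then show ?thesis using i e_nonzero e_closed by (metis r_null)
qed

lemma splitting_absorbs:
  assumes I: "I \<in> splittings" and r: "r \<in> carrier R"
  shows "E I \<otimes> r \<otimes> E I = E I \<otimes> r"
proof -
  note I' = splittingsD(2)[OF I]
  have "E I \<otimes> r = E I \<otimes> r \<otimes> (E I \<oplus> E (co I))" using E_add_co[OF I'] I' r by simp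
  also have "\<dots> = E I \<otimes> r \<otimes> E I" using splittingsD(3)[OF I r] I' r by (simp add: r_distr)
  finally show ?thesis by (rule sym)
qed

lemma annihilator_of_E:
  assumes I: "I \<subseteq> {..<s}"
  shows "{r \<in> carrier R. E I \<otimes> r = \<zero>} = E (co I) <# carrier R"
proof
  show "E (co I) <# carrier R \<subseteq> {r \<in> carrier R. E I \<otimes> r = \<zero>}"
  proof
    fix x assume "x \<in> E (co I) <# carrier R"
    then obtain r where r: "r \<in> carrier R" "x = E (co I) \<otimes> r" by (auto simp: l_coset_def)
    have "E I \<otimes> x = E I \<otimes> E (co I) \<otimes> r" using r I by (simp add: m_assoc)
    also have "\<dots> = \<zero>" using E_mult[of I "co I"] I r(1) by (simp add: Diff_Int_distrib2)
    finally show "x \<in> {r \<in> carrier R. E I \<otimes> r = \<zero>}" using r I by simp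
  qed
  show "{r \<in> carrier R. E I \<otimes> r = \<zero>} \<subseteq> E (co I) <# carrier R"
  proof
    fix r assume "r \<in> {r \<in> carrier R. E I \<otimes> r = \<zero>}"
    then have r: "r \<in> carrier R" "E I \<otimes> r = \<zero>" by auto
    have "r = (E I \<oplus> E (co I)) \<otimes> r" using E_add_co[OF I] r by simp
    also have "\<dots> = E (co I) \<otimes> r" using r I by (simp add: l_distr)
    finally show "r \<in> E (co I) <# carrier R" using r(1) unfolding l_coset_def by blast
  qed
qed

lemma splitting_ideal:
  assumes I: "I \<in> splittings"
  shows "ideal (E (co I) <# carrier R) R"
proof -
  note I' = splittingsD(2)[OF I]
  have "ideal {r \<in> carrier R. E I \<otimes> r = \<zero>} R"
  proof (rule idealI[OF ring_axioms])
    show "subgroup {r \<in> carrier R. E I \<otimes> r = \<zero>} (add_monoid R)"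
      using I' by (intro add.subgroupI) (auto simp: r_distr r_minus)
    fix a x assume a: "a \<in> {r \<in> carrier R. E I \<otimes> r = \<zero>}" and x: "x \<in> carrier R"
    then have ac: "a \<in> carrier R" "E I \<otimes> a = \<zero>" by auto
    have "E I \<otimes> (x \<otimes> a) = E I \<otimes> x \<otimes> E I \<otimes> a"
      using ac x I' splitting_absorbs[OF I x] by (simp add: m_assoc)
    also have "\<dots> = E I \<otimes> x \<otimes> (E I \<otimes> a)" using ac x I' by (simp add: m_assoc)
    also have "\<dots> = \<zero>" using ac x I' by simp
    finally show "x \<otimes> a \<in> {r \<in> carrier R. E I \<otimes> r = \<zero>}" using ac x by simp
    have "E I \<otimes> (a \<otimes> x) = E I \<otimes> a \<otimes> x" using ac(1) x I' by (simp add: m_assoc)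
    then show "a \<otimes> x \<in> {r \<in> carrier R. E I \<otimes> r = \<zero>}" using ac x by simp
  qed
  then show ?thesis by (simp add: annihilator_of_E[OF I'])
qed

text \<open>For \<open>i \<in> I\<close> the idempotent \<open>e\<^sub>i\<close> lies in \<open>e\<^sub>I R\<close>. If \<open>e\<^sub>i = e\<^sub>K r\<close>, then \<open>e\<^sub>i = (e\<^sub>i e\<^sub>K) r\<close>, and this is nonzero only if \<open>i \<in> K\<close>.\<close>

lemma E_principal_subset_iff:
  assumes I: "I \<subseteq> {..<s}" and K: "K \<subseteq> {..<s}"
  shows "E I <# carrier R \<subseteq> E K <# carrier R \<longleftrightarrow> I \<subseteq> K"
proof
  assume sub: "E I <# carrier R \<subseteq> E K <# carrier R"
  show "I \<subseteq> K"
  proof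
    fix i assume i: "i \<in> I"
    then have i_s: "i < s" using I by blast
    have "e i = E I \<otimes> e i" using i I e_E(2)[OF i_s I] by simp
    then have "e i \<in> E I <# carrier R" using e_closed[OF i_s] unfolding l_coset_def by blast
    then obtain r where r: "r \<in> carrier R" "e i = E K \<otimes> r" using sub by (auto simp: l_coset_def)
    have "e i = e i \<otimes> e i" using e_idem[OF i_s] by simp
    also have "\<dots> = e i \<otimes> (E K \<otimes> r)" using r(2) by simp
    also have "\<dots> = (e i \<otimes> E K) \<otimes> r" using r(1) K e_closed[OF i_s] by (simp add: m_assoc)
    finally have "e i \<otimes> E K \<noteq> \<zero>" using e_nonzero[OF i_s] r(1) by auto
    then show "i \<in> K" using e_E(1)[OF i_s K] by (auto split: if_splits)
  qed
next
  assume sub: "I \<subseteq> K"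
  show "E I <# carrier R \<subseteq> E K <# carrier R"
  proof
    fix x assume "x \<in> E I <# carrier R"
    then obtain r where r: "r \<in> carrier R" "x = E I \<otimes> r" by (auto simp: l_coset_def)
    have "E I = E K \<otimes> E I" using sub E_mult[OF K I] by (simp add: Int_absorb1)
    then have "x = E K \<otimes> (E I \<otimes> r)" using r I K m_assoc[of "E K" "E I" r] by simp
    moreover have "E I \<otimes> r \<in> carrier R" using r I by simp
    ultimately show "x \<in> E K <# carrier R" unfolding l_coset_def by blast
  qed
qed

lemma E_inject:
  assumes I: "I \<subseteq> {..<s}" and K: "K \<subseteq> {..<s}" and eq: "E I = E K"
  shows "I = K"
  using E_principal_subset_iff[OF I K] E_principal_subset_iff[OF K I] eq by simp

text \<open>A denominator set avoids \<open>0\<close>, which excludes the kernel \<open>R\<close> and hence \<open>I = \<emptyset>\<close>.\<close>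

theorem Loc_l_eq:
  assumes art: "left_artinian R"
  shows "Loc_l R = (\<lambda>I. quotients_by R (E (co I) <# carrier R)) ` splittings"
proof
  show "Loc_l R \<subseteq> (\<lambda>I. quotients_by R (E (co I) <# carrier R)) ` splittings"
  proof
    fix C assume "C \<in> Loc_l R"
    then obtain S and A :: "('a \<times> 'a) set ring" and \<alpha> where den: "left_denominator_set R S"
      and loc: "left_localization R S A \<alpha>" and C: "C = R_class R A \<alpha>"
      unfolding Loc_l_def by blast
    have A: "ring A" "\<alpha> \<in> ring_hom R A" using loc by (auto simp: left_localization_def)
    note L = left_artinian_localization[OF art den loc]
    obtain f where f: "f \<in> carrier R" "f \<otimes> f = f" "\<And>r. r \<in> carrier R \<Longrightarrow> f \<otimes> r \<otimes> f = f \<otimes> r"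
      and ker: "a_kernel R A \<alpha> = {r \<in> carrier R. f \<otimes> r = \<zero>}" using L(2) by blast
    obtain I where I: "I \<subseteq> {..<s}" "J +> f = J +> E I" using semicentral_lift[OF f] by blast
    note K = kernel_of_congruent_idempotent[OF f I]
    have "I \<noteq> {}"
    proof
      assume "I = {}"
      then have "a_kernel R A \<alpha> = \<one> <# carrier R" using ker K(1) by (simp add: E_full)
      moreover have "\<one> \<otimes> \<one> \<in> \<one> <# carrier R" unfolding l_coset_def by blast
      ultimately have "\<one> \<in> a_kernel R A \<alpha>" by simp
      then have "\<alpha> \<one> = \<zero>\<^bsub>A\<^esub>" unfolding a_kernel_def' by blast
      then obtain t where "t \<in> S" "t \<otimes> \<one> = \<zero>"
        using loc unfolding left_localization_def by blast
      moreover have "\<zero> \<notin> S" "S \<subseteq> carrier R"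
        using den left_denominator_set_subset[OF den]
        by (auto simp: left_denominator_set_def left_ore_set_def multiplicative_set_def)
      ultimately show False by auto
    qed
    then have "I \<in> splittings" using I(1) K(2) by (simp add: splittings_def)
    moreover have "C = quotients_by R (E (co I) <# carrier R)"
      using R_class_of_surjection[OF ring_axioms A L(1)] ker K(1) C by simp
    ultimately show "C \<in> (\<lambda>I. quotients_by R (E (co I) <# carrier R)) ` splittings" by blast
  qed
  show "(\<lambda>I. quotients_by R (E (co I) <# carrier R)) ` splittings \<subseteq> Loc_l R"
  proof
    fix C assume "C \<in> (\<lambda>I. quotients_by R (E (co I) <# carrier R)) ` splittings"
    then obtain I where I: "I \<in> splittings" and C: "C = quotients_by R (E (co I) <# carrier R)" by blast
    note I' = splittingsD(2)[OF I]
    let ?K = "E (co I) <# carrier R"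
    have K: "ideal ?K R" by (rule splitting_ideal[OF I])
    note q = quotient_map_properties[OF K]
    have E: "E I \<in> carrier R" "E I \<otimes> E I = E I" "E I \<noteq> \<zero>"
      using I' E_mult E_nonzero splittingsD(1)[OF I] by auto
    have ker: "a_kernel R (R Quot ?K) (\<lambda>r. ?K +> r) = {r \<in> carrier R. E I \<otimes> r = \<zero>}"
      using q(3) annihilator_of_E[OF I'] by simp
    have "R_class R (R Quot ?K) (\<lambda>r. ?K +> r) \<in> Loc_l R"
      using localization_at_idempotent[OF E splitting_absorbs[OF I] ideal.quotient_is_ring[OF K] q(1,2) ker]
      by (rule R_class_in_Loc_l)
    then show "C \<in> Loc_l R" using quot_class_eq[OF K] C by simp
  qed
qed

end


section \<open>Passage to the opposite ring\<close>

lemma a_r_coset_opp_ring [simp]: "I +>\<^bsub>opp_ring R\<^esub> x = I +>\<^bsub>R\<^esub> x"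
  by (simp add: a_r_coset_def')

lemma l_coset_opp_ring [simp]: "x <#\<^bsub>opp_ring R\<^esub> H = H #>\<^bsub>R\<^esub> x"
  by (simp add: l_coset_def r_coset_def)

lemma ideal_opp_ring:
  assumes "ideal I R"
  shows "ideal I (opp_ring R)"
proof -
  interpret ideal I R by fact
  have "add_monoid (opp_ring R) = add_monoid R" by (simp add: opp_ring_def)
  then show ?thesis
    using a_subgroup I_l_closed I_r_closed
    by (intro idealI ring_opp_ring ring_axioms) auto
qed

context lifted_idempotents
begin

text \<open>A right semicentral idempotent \<open>f\<close> of the opposite ring satisfies \<open>f r f = r f\<close> in \<open>R\<close>; then \<open>1 - f\<close> is
right semicentral in \<open>R\<close>, and its index set is the complement of the one sought for \<open>f\<close>.\<close>

lemma lifted_idempotents_opp: "lifted_idempotents (opp_ring R) e s J"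
proof (intro lifted_idempotents.intro lifted_idempotents_axioms.intro)
  show "orthogonal_idempotents (opp_ring R) e s"
    by (rule orthogonal_idempotents_opp) (rule orthogonal_idempotents_axioms)
  show "ideal J (opp_ring R)" by (rule ideal_opp_ring[OF J_ideal])
next
  fix f assume "f \<in> carrier (opp_ring R)" "f \<otimes>\<^bsub>opp_ring R\<^esub> f = f"
    and "\<And>r. r \<in> carrier (opp_ring R) \<Longrightarrow> f \<otimes>\<^bsub>opp_ring R\<^esub> r \<otimes>\<^bsub>opp_ring R\<^esub> f = f \<otimes>\<^bsub>opp_ring R\<^esub> r"
  then have f: "f \<in> carrier R" "f \<otimes> f = f" "\<And>r. r \<in> carrier R \<Longrightarrow> f \<otimes> (r \<otimes> f) = r \<otimes> f"
    by auto
  let ?k = "\<one> \<ominus> f"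
  have fk: "f \<otimes> ?k = \<zero>" using f by (simp add: minus_eq r_distr r_minus r_neg)
  have kf: "?k \<otimes> f = \<zero>" using f by (simp add: minus_eq l_distr l_minus r_neg)
  have kk: "?k \<otimes> ?k = ?k"
  proof -
    have "?k \<otimes> ?k = ?k \<ominus> ?k \<otimes> f" using f(1) by (simp add: minus_eq r_distr r_minus)
    then show ?thesis using kf f(1) by (simp add: minus_eq)
  qed
  have abs: "?k \<otimes> r \<otimes> ?k = ?k \<otimes> r" if r: "r \<in> carrier R" for r
  proof -
    have "?k \<otimes> (r \<otimes> f) = r \<otimes> f \<ominus> f \<otimes> (r \<otimes> f)"
      using f(1) r by (simp add: minus_eq l_distr l_minus)
    also have "\<dots> = \<zero>" unfolding f(3)[OF r] using f(1) r by (simp add: minus_eq r_neg)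
    finally have 0: "?k \<otimes> (r \<otimes> f) = \<zero>" .
    have "x \<otimes> ?k = x \<ominus> x \<otimes> f" if "x \<in> carrier R" for x
      using that f(1) by (simp add: minus_eq r_distr r_minus)
    then have "?k \<otimes> r \<otimes> ?k = ?k \<otimes> r \<ominus> ?k \<otimes> r \<otimes> f"
      using f(1) r by simp
    also have "?k \<otimes> r \<otimes> f = \<zero>" using 0 f(1) r by (simp add: m_assoc)
    finally show ?thesis using f(1) r by (simp add: minus_eq)
  qed
  obtain I where I: "I \<subseteq> {..<s}" "J +> ?k = J +> E I"
    using semicentral_lift[OF _ kk abs] f(1) by auto
  interpret J: ideal J R by (rule J_ideal)
  have "?k \<ominus> E I \<in> J"
    using I f(1) quotient_eq_iff_same_a_r_cos[OF J_ideal] by simp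
  moreover have "f \<ominus> E (co I) = \<ominus> (?k \<ominus> E I)"
  proof -
    have "?k \<ominus> E I = (\<one> \<ominus> f) \<ominus> (\<one> \<ominus> E (co I))"
      using one_minus_E[of "co I"] I(1) by (simp add: double_diff)
    also have "\<dots> = E (co I) \<ominus> f" using minus_diff_swap f(1) by simp
    finally have "\<ominus> (?k \<ominus> E I) = \<ominus> (E (co I) \<ominus> f)" by simp
    also have "\<dots> = f \<ominus> E (co I)" using f(1) by (simp add: minus_eq minus_add a_comm)
    finally show ?thesis by (rule sym)
  qed
  ultimately have "f \<ominus> E (co I) \<in> J" using J.a_inv_closed by simp
  then have "J +> f = J +> E (co I)"
    using f(1) quotient_eq_iff_same_a_r_cos[OF J_ideal] by simp
  then show "\<exists>I\<subseteq>{..<s}. J +>\<^bsub>opp_ring R\<^esub> f = J +>\<^bsub>opp_ring R\<^esub> idem_sum (opp_ring R) e I"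
    by (intro exI[of _ "co I"]) simp
qed (use J_idempotent e_nonzero one_nonzero in auto)

end

lemma R_class_opp_ring: "R_class R A \<alpha> = map_prod opp_ring id ` R_class (opp_ring R) (opp_ring A) \<alpha>"
proof -
  have "(B, \<tau>) \<in> R_class R A \<alpha> \<longleftrightarrow> (opp_ring B, \<tau>) \<in> R_class (opp_ring R) (opp_ring A) \<alpha>"
    for B :: "('a \<times> 'a) set ring" and \<tau>
    using ring_opp_ring[of B] ring_opp_ring[of "opp_ring B"]
    by (auto simp: R_class_def R_iso_def)
  then show ?thesis
    by (force simp: image_iff intro: opp_ring_simps(6)[symmetric])
qed

lemma quotients_by_opp_ring: "quotients_by R K = map_prod opp_ring id ` quotients_by (opp_ring R) K"
proof -
  have "(B, \<tau>) \<in> quotients_by R K \<longleftrightarrow> (opp_ring B, \<tau>) \<in> quotients_by (opp_ring R) K"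
    for B :: "('a \<times> 'a) set ring" and \<tau>
    using ring_opp_ring[of B] ring_opp_ring[of "opp_ring B"]
    by (auto simp: quotients_by_def a_kernel_def')
  then show ?thesis
    by (force simp: image_iff intro: opp_ring_simps(6)[symmetric])
qed

text \<open>A class of localizations of \<open>R\<close> consists of \<open>R\<close>-rings and one of the opposite ring consists of
\<open>R\<^sup>o\<^sup>p\<close>-rings; taking opposites elementwise is the translation between them.\<close>

lemma Loc_r_opp_ring: "Loc_r R = (`) (map_prod opp_ring id) ` Loc_l (opp_ring R)"
proof
  show "Loc_r R \<subseteq> (`) (map_prod opp_ring id) ` Loc_l (opp_ring R)"
    unfolding Loc_r_def Loc_l_def right_denominator_set_def right_localization_def
    using R_class_opp_ring[of R] by blast
  show "(`) (map_prod opp_ring id) ` Loc_l (opp_ring R) \<subseteq> Loc_r R"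
  proof
    fix C assume "C \<in> (`) (map_prod opp_ring id) ` Loc_l (opp_ring R)"
    then obtain S and A :: "('a \<times> 'a) set ring" and \<alpha> where
      den: "left_denominator_set (opp_ring R) S" and loc: "left_localization (opp_ring R) S A \<alpha>"
      and C: "C = map_prod opp_ring id ` R_class (opp_ring R) A \<alpha>"
      unfolding Loc_l_def by blast
    have "C = R_class R (opp_ring A) \<alpha>" using R_class_opp_ring[of R "opp_ring A"] C by simp
    moreover have "right_denominator_set R S" "right_localization R S (opp_ring A) \<alpha>"
      using den loc by (simp_all add: right_denominator_set_def right_localization_def)
    ultimately show "C \<in> Loc_r R" unfolding Loc_r_def by blast
  qed
qed

context lifted_idempotents
begin

definition proper_splittings :: "nat set set" where
  "proper_splittings = splittings - {{..<s}}"

lemma proper_splittings_opp: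
  "lifted_idempotents.proper_splittings (opp_ring R) e s = co ` proper_splittings"
proof -
  interpret O: lifted_idempotents "opp_ring R" e s J by (rule lifted_idempotents_opp)
  have "I \<in> O.proper_splittings \<longleftrightarrow> I \<subseteq> {..<s} \<and> co I \<in> proper_splittings" for I
  proof (cases "I \<subseteq> {..<s}")
    case True
    then have "co (co I) = I" by (simp add: double_diff)
    then show ?thesis using True
      by (auto simp: O.proper_splittings_def proper_splittings_def O.splittings_def splittings_def m_assoc)
  qed (simp add: O.proper_splittings_def O.splittings_def)
  then have 1: "O.proper_splittings = {I. I \<subseteq> {..<s} \<and> co I \<in> proper_splittings}" by blast
  have "I \<subseteq> {..<s}" if "I \<in> proper_splittings" for I
    using that by (simp add: proper_splittings_def splittings_def)
  then have "co (co I) = I" if "I \<in> proper_splittings" for I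
    using that by (simp add: double_diff)
  then show ?thesis unfolding 1 by (auto simp: image_iff double_diff)
qed

lemma full_splitting: "{..<s} \<in> splittings"
proof -
  have "s \<noteq> 0" using E_full one_nonzero by (metis E_empty lessThan_0)
  then show ?thesis by (auto simp: splittings_def E_full)
qed

lemma Loc_l_minus_base:
  assumes art: "left_artinian R"
  shows "Loc_l R - {base_class R} = (\<lambda>I. quotients_by R (E (co I) <# carrier R)) ` proper_splittings"
    and "base_class R \<in> Loc_l R"
proof -
  let ?Q = "\<lambda>I. quotients_by R (E (co I) <# carrier R)"
  have "\<zero> <# carrier R = {\<zero>}" by (auto simp: l_coset_def)
  then have base: "base_class R = ?Q {..<s}"
    using base_class_eq[OF ring_axioms] by simp
  have inj: "?Q I = ?Q K \<longleftrightarrow> I = K" if "I \<in> splittings" "K \<in> splittings" for I K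
  proof -
    have "?Q I = ?Q K \<longleftrightarrow> E (co I) <# carrier R = E (co K) <# carrier R"
      by (rule quotients_by_eq_iff[OF splitting_ideal[OF that(1)]])
    also have "\<dots> \<longleftrightarrow> co I = co K"
      using E_principal_subset_iff[of "co I" "co K"] E_principal_subset_iff[of "co K" "co I"] by auto
    also have "\<dots> \<longleftrightarrow> I = K" using splittingsD(2) that by blast
    finally show ?thesis .
  qed
  show "Loc_l R - {base_class R} = ?Q ` proper_splittings"
    unfolding Loc_l_eq[OF art] base proper_splittings_def using inj full_splitting by blast
  show "base_class R \<in> Loc_l R"
    unfolding Loc_l_eq[OF art] base using full_splitting by blast
qed

text \<open>The left classification over the opposite ring, whose proper splittings are the complements of those of
\<open>R\<close>: the kernels \<open>R e\<^sub>C\<^sub>K\<close> with \<open>K = CI\<close> become \<open>R e\<^sub>I\<close>.\<close>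

lemma Loc_r_minus_base:
  assumes art: "right_artinian R"
  shows "Loc_r R - {base_class R} = (\<lambda>I. quotients_by R (carrier R #> E I)) ` proper_splittings"
    and "base_class R \<in> Loc_r R"
proof -
  interpret O: lifted_idempotents "opp_ring R" e s J by (rule lifted_idempotents_opp)
  let ?m = "(`) (map_prod opp_ring id) :: 'a R_ring set \<Rightarrow> 'a R_ring set"
  have art': "left_artinian (opp_ring R)" using art by (simp add: right_artinian_def)
  note L = O.Loc_l_minus_base[OF art']
  have "inj ?m"
  proof (rule inj_onI)
    fix C D :: "'a R_ring set" assume "?m C = ?m D"
    then have "?m (?m C) = ?m (?m D)" by simp
    moreover have "?m (?m H) = H" for H by (simp add: image_image map_prod_def case_prod_beta)
    ultimately show "C = D" by simp
  qed
  have base: "base_class R = ?m (base_class (opp_ring R))"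
    using quotients_by_opp_ring[of R "{\<zero>}"] base_class_eq[OF ring_axioms]
      base_class_eq[OF O.ring_axioms] by simp
  have "Loc_r R - {base_class R} = ?m ` (Loc_l (opp_ring R) - {base_class (opp_ring R)})"
    unfolding base Loc_r_opp_ring using \<open>inj ?m\<close> by (simp add: image_set_diff)
  also have "\<dots> = (\<lambda>I. ?m (quotients_by (opp_ring R) (carrier R #> E I))) ` proper_splittings"
    unfolding L(1) proper_splittings_opp
  proof (subst (1 2) image_image, rule image_cong)
    fix I assume "I \<in> proper_splittings"
    then have "co (co I) = I" by (simp add: proper_splittings_def splittings_def double_diff)
    then show "?m (quotients_by (opp_ring R) (idem_sum (opp_ring R) e (co (co I)) <#\<^bsub>opp_ring R\<^esub> carrier (opp_ring R)))
       = ?m (quotients_by (opp_ring R) (carrier R #> E I))" by simp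
  qed simp
  also have "\<dots> = (\<lambda>I. quotients_by R (carrier R #> E I)) ` proper_splittings"
    unfolding quotients_by_opp_ring[of R, symmetric] ..
  finally show "Loc_r R - {base_class R} = (\<lambda>I. quotients_by R (carrier R #> E I)) ` proper_splittings" .
  show "base_class R \<in> Loc_r R" unfolding base Loc_r_opp_ring using L(2) by blast
qed

end


section \<open>The anti-isomorphism\<close>

context lifted_idempotents
begin

lemma proper_splittingsD:
  assumes "I \<in> proper_splittings"
  shows "I \<in> splittings" "I \<subseteq> {..<s}"
  using assms splittingsD(2) by (auto simp: proper_splittings_def)

text \<open>The set \<open>idem_l\<close> records idempotents instead of index sets; no information is lost as \<open>I \<mapsto> e\<^sub>I\<close> is
injective.\<close>

lemma E_in_idem_l_iff:
  assumes I: "I \<subseteq> {..<s}"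
  shows "E I \<in> idem_l R s e \<longleftrightarrow> I \<in> proper_splittings"
proof -
  have coset: "(E K <# carrier R) #> E (co K) = {\<zero>} \<longleftrightarrow> (\<forall>r\<in>carrier R. E K \<otimes> r \<otimes> E (co K) = \<zero>)" for K
  proof -
    have "(E K <# carrier R) #> E (co K) = (\<lambda>r. E K \<otimes> r \<otimes> E (co K)) ` carrier R"
      by (auto simp: l_coset_def r_coset_def)
    moreover have "f ` carrier R = {\<zero>} \<longleftrightarrow> (\<forall>r\<in>carrier R. f r = \<zero>)" for f :: "'a \<Rightarrow> 'a"
    proof
      assume "\<forall>r\<in>carrier R. f r = \<zero>"
      then have "f ` carrier R = (\<lambda>r. \<zero>) ` carrier R" by (intro image_cong) auto
      also have "\<dots> = {\<zero>}" by (rule image_constant[OF zero_closed])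
      finally show "f ` carrier R = {\<zero>}" .
    qed blast
    ultimately show ?thesis by simp
  qed
  have "E I \<in> idem_l R s e \<longleftrightarrow> (\<exists>K. E I = E K \<and> K \<in> proper_splittings)"
    unfolding idem_l_def coset proper_splittings_def splittings_def by blast
  also have "\<dots> \<longleftrightarrow> I \<in> proper_splittings"
    using E_inject[OF I] proper_splittingsD(2) by blast
  finally show ?thesis .
qed

lemma splitting_ideal_right:
  assumes I: "I \<in> proper_splittings"
  shows "ideal (carrier R #> E I) R"
proof -
  interpret O: lifted_idempotents "opp_ring R" e s J by (rule lifted_idempotents_opp)
  have "co I \<in> O.splittings"
    using I proper_splittings_opp O.proper_splittingsD(1) by blast
  then have "ideal (E (co (co I)) <#\<^bsub>opp_ring R\<^esub> carrier R) (opp_ring R)"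
    using O.splitting_ideal by simp
  then have "ideal (carrier R #> E I) (opp_ring R)"
    using proper_splittingsD(2)[OF I] by (simp add: double_diff)
  then show ?thesis using ideal_opp_ring by fastforce
qed

lemma E_right_principal_subset_iff:
  assumes "I \<subseteq> {..<s}" "K \<subseteq> {..<s}"
  shows "carrier R #> E I \<subseteq> carrier R #> E K \<longleftrightarrow> I \<subseteq> K"
proof -
  interpret O: lifted_idempotents "opp_ring R" e s J by (rule lifted_idempotents_opp)
  show ?thesis using O.E_principal_subset_iff[OF assms] by simp
qed

text \<open>With \<open>L I\<close> the class of \<open>R/e\<^sub>C\<^sub>I R\<close> and \<open>U I\<close> the class of \<open>R/R e\<^sub>I\<close>, the map \<open>\<phi>\<close> sends \<open>L I\<close> to \<open>U I\<close>.
Injectivity of both parametrisations follows from the order statements.\<close>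

theorem localization_posets_anti_isomorphic:
  assumes "left_artinian R" "right_artinian R"
  shows
    "Loc_l R - {base_class R} =
       {quot_class R ((\<one> \<ominus> E I) <# carrier R) | I. I \<subseteq> {..<s} \<and> E I \<in> idem_l R s e} \<and>
     (\<exists>\<phi>. bij_betw \<phi> (Loc_l R - {base_class R}) (Loc_r R - {base_class R}) \<and>
        (\<forall>I \<subseteq> {..<s}. E I \<in> idem_l R s e \<longrightarrow>
           \<phi> (quot_class R ((\<one> \<ominus> E I) <# carrier R)) =
             quot_class R (carrier R #> (\<one> \<ominus> E (co I)))) \<and>
        (\<forall>C \<in> Loc_l R - {base_class R}. \<forall>D \<in> Loc_l R - {base_class R}.
           loc_le R C D \<longleftrightarrow> loc_le R (\<phi> D) (\<phi> C))) \<and>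
     Loc_l R \<approx> Loc_r R"
proof -
  let ?P = proper_splittings
  define L where "L I = quotients_by R (E (co I) <# carrier R)" for I
  define U where "U I = quotients_by R (carrier R #> E I)" for I
  note P = proper_splittingsD
  have L: "Loc_l R - {base_class R} = L ` ?P" and U: "Loc_r R - {base_class R} = U ` ?P"
    using Loc_l_minus_base(1)[OF assms(1)] Loc_r_minus_base(1)[OF assms(2)]
    by (simp_all add: L_def[abs_def] U_def[abs_def])
  have quot_l: "quot_class R ((\<one> \<ominus> E I) <# carrier R) = L I" if I: "I \<in> ?P" for I
    using quot_class_eq[OF splitting_ideal[OF P(1)[OF I]]] one_minus_E[OF P(2)[OF I]]
    by (simp add: L_def)
  have quot_r: "quot_class R (carrier R #> (\<one> \<ominus> E (co I))) = U I" if I: "I \<in> ?P" for I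
    using quot_class_eq[OF splitting_ideal_right[OF I]] one_minus_E[of "co I"] P(2)[OF I]
    by (simp add: U_def double_diff)
  have L_le: "loc_le R (L I) (L K) \<longleftrightarrow> K \<subseteq> I" if "I \<in> ?P" "K \<in> ?P" for I K
  proof -
    have "loc_le R (L I) (L K) \<longleftrightarrow> co I \<subseteq> co K"
      unfolding L_def loc_le_quotients_by_iff[OF splitting_ideal[OF P(1)[OF that(1)]] splitting_ideal[OF P(1)[OF that(2)]]]
      by (rule E_principal_subset_iff) auto
    then show ?thesis using P(2) that by blast
  qed
  have U_le: "loc_le R (U I) (U K) \<longleftrightarrow> I \<subseteq> K" if "I \<in> ?P" "K \<in> ?P" for I K
    unfolding U_def loc_le_quotients_by_iff[OF splitting_ideal_right[OF that(1)] splitting_ideal_right[OF that(2)]]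
    by (rule E_right_principal_subset_iff) (rule P(2)[OF that(1)], rule P(2)[OF that(2)])
  have inj_L: "inj_on L ?P"
  proof (rule inj_onI)
    fix I K assume IK: "I \<in> ?P" "K \<in> ?P" "L I = L K"
    then have "loc_le R (L I) (L K) \<longleftrightarrow> loc_le R (L I) (L I)" "loc_le R (L K) (L I) \<longleftrightarrow> loc_le R (L I) (L I)"
      by simp_all
    then show "I = K" using L_le IK(1,2) by blast
  qed
  have inj_U: "inj_on U ?P"
  proof (rule inj_onI)
    fix I K assume IK: "I \<in> ?P" "K \<in> ?P" "U I = U K"
    then have "loc_le R (U I) (U K) \<longleftrightarrow> loc_le R (U I) (U I)" "loc_le R (U K) (U I) \<longleftrightarrow> loc_le R (U I) (U I)"
      by simp_all
    then show "I = K" using U_le IK(1,2) by blast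
  qed
  define \<phi> where "\<phi> = U \<circ> the_inv_into ?P L"
  have \<phi>: "\<phi> (L I) = U I" if "I \<in> ?P" for I
    using that inj_L by (simp add: \<phi>_def the_inv_into_f_f)
  have bij: "bij_betw \<phi> (Loc_l R - {base_class R}) (Loc_r R - {base_class R})"
    unfolding L U \<phi>_def
    using bij_betw_trans[OF bij_betw_the_inv_into[OF inj_on_imp_bij_betw[OF inj_L]]
        inj_on_imp_bij_betw[OF inj_U]] .
  have ord: "loc_le R C D \<longleftrightarrow> loc_le R (\<phi> D) (\<phi> C)" if CD: "C \<in> L ` ?P" "D \<in> L ` ?P" for C D
  proof -
    obtain I K where IK: "I \<in> ?P" "K \<in> ?P" "C = L I" "D = L K" using CD by blast
    then show ?thesis using L_le[OF IK(1,2)] U_le[OF IK(2,1)] \<phi> by simp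
  qed
  have class_l: "L ` ?P = {quot_class R ((\<one> \<ominus> E I) <# carrier R) | I. I \<subseteq> {..<s} \<and> E I \<in> idem_l R s e}"
  proof (intro equalityI subsetI)
    fix C assume "C \<in> L ` ?P"
    then obtain I where I: "I \<in> ?P" "C = L I" by blast
    then have "C = quot_class R ((\<one> \<ominus> E I) <# carrier R)" "I \<subseteq> {..<s}" "E I \<in> idem_l R s e"
      using quot_l P(2) E_in_idem_l_iff by auto
    then show "C \<in> {quot_class R ((\<one> \<ominus> E I) <# carrier R) | I. I \<subseteq> {..<s} \<and> E I \<in> idem_l R s e}"
      by blast
  next
    fix C assume "C \<in> {quot_class R ((\<one> \<ominus> E I) <# carrier R) | I. I \<subseteq> {..<s} \<and> E I \<in> idem_l R s e}"
    then obtain I where I: "I \<in> ?P" "C = quot_class R ((\<one> \<ominus> E I) <# carrier R)"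
      using E_in_idem_l_iff by blast
    then show "C \<in> L ` ?P" using quot_l by blast
  qed
  have map: "\<phi> (quot_class R ((\<one> \<ominus> E I) <# carrier R)) = quot_class R (carrier R #> (\<one> \<ominus> E (co I)))"
    if "I \<subseteq> {..<s}" "E I \<in> idem_l R s e" for I
    using that E_in_idem_l_iff \<phi> by (simp add: quot_l quot_r)
  have equinum: "Loc_l R \<approx> Loc_r R"
  proof -
    have "Loc_l R - {base_class R} \<approx> Loc_r R - {base_class R}"
      using bij unfolding eqpoll_def by blast
    then have "insert (base_class R) (Loc_l R - {base_class R}) \<approx> insert (base_class R) (Loc_r R - {base_class R})"
      by (rule insert_eqpoll_cong) auto
    then show ?thesis
      using Loc_l_minus_base(2)[OF assms(1)] Loc_r_minus_base(2)[OF assms(2)]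
      by (simp add: insert_absorb)
  qed
  show ?thesis
  proof (intro conjI exI[of _ \<phi>] allI impI ballI)
    show "Loc_l R - {base_class R} =
       {quot_class R ((\<one> \<ominus> E I) <# carrier R) | I. I \<subseteq> {..<s} \<and> E I \<in> idem_l R s e}"
      using L class_l by (rule trans)
  qed (use bij map ord[folded L] equinum in blast)+
qed

end

text \<open>No \<open>e\<^sub>i\<close> vanishes, since its image has the coordinate \<open>1 \<noteq> 0\<close> in the simple factor \<open>i\<close>.\<close>

lemma (in orthogonal_idempotents) lifted_idempotents_of_semisimple_quotient:
  assumes nz: "\<one> \<noteq> \<zero>" and len: "length Rs = s"
    and simple: "\<And>i. i < s \<Longrightarrow> simple_artinian (Rs ! i)"
    and \<psi>: "\<psi> \<in> ring_iso (R Quot jacobson_radical R) (RDirProd_list Rs)"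
    and \<psi>e: "\<And>i. i < s \<Longrightarrow> \<psi> (jacobson_radical R +> e i) = factor_one Rs i"
  shows "lifted_idempotents R e s (jacobson_radical R)"
proof (intro lifted_idempotents.intro lifted_idempotents_axioms.intro)
  let ?J = "jacobson_radical R"
  show J: "ideal ?J R" by (rule jacobson_radical_ideal)
  show "x = \<zero>" if "x \<in> ?J" "x \<otimes> x = x" for x
    using idempotent_in_radical that .
  show "e i \<noteq> \<zero>" if i: "i < s" for i
  proof
    assume "e i = \<zero>"
    have rings: "ring (Rs ! j)" if "j < length Rs" for j
      using simple that len by (simp add: simple_artinian_def)
    have hom: "(\<lambda>r. \<psi> (?J +> r) ! i) \<in> ring_hom R (Rs ! i)"
      using ring_hom_trans[OF ring_hom_trans[OF quotient_map_properties(1)[OF J], of \<psi>]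
          RDirProd_list_coordinate_hom, of Rs i] \<psi> i len
      by (simp add: comp_def ring_iso_def)
    have "\<one>\<^bsub>Rs ! i\<^esub> = \<psi> (?J +> e i) ! i"
      using \<psi>e[OF i] i len by (simp add: factor_one_def)
    also have "\<dots> = \<zero>\<^bsub>Rs ! i\<^esub>"
      using ring_hom_zero[OF hom ring_axioms rings] i len \<open>e i = \<zero>\<close> by simp
    finally show False using simple[OF i] by (simp add: simple_artinian_def)
  qed
  show "\<one> \<noteq> \<zero>" by (rule nz)
  show "\<exists>I\<subseteq>{..<s}. ?J +> f = ?J +> E I"
    if "f \<in> carrier R" "f \<otimes> f = f" "\<And>r. r \<in> carrier R \<Longrightarrow> f \<otimes> r \<otimes> f = f \<otimes> r" for f
    using semicentral_idempotent_mod_ideal[OF J len simple \<psi> \<psi>e that(1,3)] .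
qed (rule orthogonal_idempotents_axioms)

theorem theorem4p12:
  fixes R :: "('a, 'm) ring_scheme" (structure)
    and Rs :: "('b, 'n) ring_scheme list"
    and \<psi> :: "'a set \<Rightarrow> 'b list"
    and e :: "nat \<Rightarrow> 'a"
    and s :: nat
  assumes "ring R" and "\<one> \<noteq> \<zero>"
    and "left_artinian R" and "right_artinian R"
    and "length Rs = s"
    and "\<And>i. i < s \<Longrightarrow> simple_artinian (Rs ! i)"
    and "\<psi> \<in> ring_iso (R Quot jacobson_radical R) (RDirProd_list Rs)"
    and "\<And>i. i < s \<Longrightarrow> e i \<in> carrier R"
    and "\<And>i. i < s \<Longrightarrow> e i \<otimes> e i = e i"
    and "\<And>i j. i < s \<Longrightarrow> j < s \<Longrightarrow> i \<noteq> j \<Longrightarrow> e i \<otimes> e j = \<zero>"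
    and "\<one> = (\<Oplus>i\<in>{..<s}. e i)"
    and "\<And>i. i < s \<Longrightarrow> \<psi> (jacobson_radical R +> e i) = factor_one Rs i"
  shows
    "Loc_l R - {base_class R} =
       {quot_class R ((\<one> \<ominus> idem_sum R e I) <# carrier R) | I.
          I \<subseteq> {..<s} \<and> idem_sum R e I \<in> idem_l R s e} \<and>
     (\<exists>\<phi>. bij_betw \<phi> (Loc_l R - {base_class R}) (Loc_r R - {base_class R}) \<and>
        (\<forall>I \<subseteq> {..<s}. idem_sum R e I \<in> idem_l R s e \<longrightarrow>
           \<phi> (quot_class R ((\<one> \<ominus> idem_sum R e I) <# carrier R)) =
             quot_class R (carrier R #> (\<one> \<ominus> idem_sum R e ({..<s} - I)))) \<and>
        (\<forall>C \<in> Loc_l R - {base_class R}. \<forall>D \<in> Loc_l R - {base_class R}.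
           loc_le R C D \<longleftrightarrow> loc_le R (\<phi> D) (\<phi> C))) \<and>
     Loc_l R \<approx> Loc_r R"
proof -
  interpret orthogonal_idempotents R e s
    using assms(1,8-11) by (intro orthogonal_idempotents.intro orthogonal_idempotents_axioms.intro)
  interpret lifted_idempotents R e s "jacobson_radical R"
    by (rule lifted_idempotents_of_semisimple_quotient[OF assms(2,5,6,7,12)])
  show ?thesis by (rule localization_posets_anti_isomorphic[OF assms(3,4)])
qed

end
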